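(* Let $k \geq 1$ be an integer, and let $\mathsf{V} = \mathbb{C}x \oplus \mathbb{C}y$ be the natural two-dimensional module of the Lie superalgebra $\mathfrak{gl}(1|1)$ over $\mathbb{C}$. For each subset $\mathsf{s} \subseteq \{1,\dots,k-1\}$ let $\mathsf{V}_{\mathsf{s}} = \mathrm{span}_{\mathbb{C}}\{v_{\mathsf{s}}, f v_{\mathsf{s}}\} \subseteq \mathsf{V}^{\otimes k}$, where $v_{\mathsf{s}} = e(y \otimes u_{\mathsf{s}})$ and $u_{\mathsf{s}} = u_1 \otimes \cdots \otimes u_{k-1}$ with $u_i = x$ if $i \in \mathsf{s}$ and $u_i = y$ if $i \notin \mathsf{s}$. Then, as $\mathfrak{gl}(1|1)$-modules, $$\mathsf{V}^{\otimes k} = \bigoplus_{\mathsf{s} \subseteq \{1,\dots,k-1\}} \mathsf{V}_{\mathsf{s}} \;\cong\; \bigoplus_{\ell=0}^{k-1} \binom{k-1}{\ell}\, \mathsf{L}[\ell+1,\,k-1-\ell],$$ where the first equality is an internal direct sum of $\mathfrak{gl}(1|1)$-submodules, and $\binom{k-1}{\ell}\mathsf{L}[\ell+1,k-1-\ell]$ denotes a direct sum of $\binom{k-1}{\ell}$ copies of the irreducible module $\mathsf{L}[\ell+1,k-1-\ell]$.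
   Context: The Lie superalgebra $\mathfrak{gl}(1|1) = \mathfrak{g}_0 \oplus \mathfrak{g}_1$ over $\mathbb{C}$ consists of all $2\times 2$ complex matrices with bracket $[a,b] = ab - (-1)^{\alpha\beta}ba$ for $a \in \mathfrak{g}_\alpha$, $b \in \mathfrak{g}_\beta$, $\alpha,\beta \in \mathbb{Z}/2\mathbb{Z}$. It has basis $e = \begin{pmatrix}0&1\\0&0\end{pmatrix}$, $f = \begin{pmatrix}0&0\\1&0\end{pmatrix}$, $h_1 = \begin{pmatrix}1&0\\0&0\end{pmatrix}$, $h_2 = \begin{pmatrix}0&0\\0&1\end{pmatrix}$, with $\mathfrak{g}_0 = \mathbb{C}h_1 \oplus \mathbb{C}h_2$ and $\mathfrak{g}_1 = \mathbb{C}e \oplus \mathbb{C}f$. The natural module is $\mathsf{V} = \mathsf{V}_0 \oplus \mathsf{V}_1$ with $\mathsf{V}_0 = \mathbb{C}x$, $\mathsf{V}_1 = \mathbb{C}y$, identified with $2\times 1$ column matrices with $x = (1,0)^T$, $y = (0,1)^T$, and action by matrix multiplication: $ex = 0$, $ey = x$, $fx = y$, $fy = 0$, $h_1x = x$, $h_1y = 0$, $h_2x = 0$, $h_2y = y$. The action on tensor products is $a(v \otimes w) = av \otimes w + (-1)^{\alpha\beta} v \otimes aw$ for $a \in \mathfrak{g}_\alpha$ and $v$ homogeneous of degree $\beta$; iterating this gives the action on $\mathsf{V}^{\otimes k}$. Thus $v_{\mathsf{s}} = e(y\otimes u_{\mathsf{s}}) = x \otimes u_{\mathsf{s}} - y \otimes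 e u_{\mathsf{s}}$. (For $k=1$, the only subset is $\mathsf{s} = \emptyset$, $y \otimes u_{\emptyset}$ means $y$, and $v_\emptyset = ey = x$.) A highest weight vector of weight $[m,n]$ ($m,n$ integers) in a $\mathfrak{gl}(1|1)$-module is a nonzero vector $w$ with $ew = 0$, $h_1w = mw$, $h_2w = nw$. $\mathsf{L}[m,n]$ denotes the finite-dimensional irreducible $\mathfrak{gl}(1|1)$-module having a highest weight vector of weight $[m,n]$; it is determined up to isomorphism by the pair $[m,n]$ (isomorphisms are not required to preserve parity). *)

theory Defs
  imports "HOL-Analysis.Analysis" "HOL-Library.Function_Algebras"
begin

section \<open>Complex vector spaces\<close>

class complex_vector = ab_group_add +
  fixes scaleC :: "complex \<Rightarrow> 'a \<Rightarrow> 'a"  (infixr \<open>*\<^sub>C\<close> 75)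
  assumes scaleC_add_right: "c *\<^sub>C (u + v) = c *\<^sub>C u + c *\<^sub>C v"
    and scaleC_add_left: "(c + d) *\<^sub>C v = c *\<^sub>C v + d *\<^sub>C v"
    and scaleC_scaleC: "c *\<^sub>C d *\<^sub>C v = (c * d) *\<^sub>C v"
    and scaleC_one: "1 *\<^sub>C v = v"

global_interpretation cvec: vector_space "scaleC :: complex \<Rightarrow> 'a \<Rightarrow> 'a::complex_vector"
  by standard (simp_all add: scaleC_add_right scaleC_add_left scaleC_scaleC scaleC_one)

instantiation complex :: complex_vector
begin
definition "c *\<^sub>C (z::complex) = c * z"
instance by standard (simp_all add: scaleC_complex_def algebra_simps)
end

instantiation "fun" :: (type, complex_vector) complex_vector
begin
definition "c *\<^sub>C f = (\<lambda>i. c *\<^sub>C f i)"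
instance
  by standard
    (simp_all add: scaleC_fun_def fun_eq_iff scaleC_add_right scaleC_add_left scaleC_scaleC
      scaleC_one)
end

instantiation vec :: (complex_vector, finite) complex_vector
begin
definition "c *\<^sub>C v = (\<chi> i. c *\<^sub>C (v $ i))"
instance
  by standard
    (simp_all add: scaleC_vec_def vec_eq_iff scaleC_add_right scaleC_add_left scaleC_scaleC
      scaleC_one)
end

section \<open>The Lie superalgebra gl(1|1)\<close>

text \<open>Degrees in Z/2Z are represented by the natural numbers 0 and 1.\<close>

type_synonym gl11 = "complex^2^2"

definition gl_part :: "nat \<Rightarrow> gl11 set" where
  "gl_part \<alpha> = {a. \<forall>i j. a $ i $ j \<noteq> 0 \<longrightarrow> \<alpha> = (if i = j then 0 else 1)}"

definition bracket :: "nat \<Rightarrow> nat \<Rightarrow> gl11 \<Rightarrow> gl11 \<Rightarrow> gl11" where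
  "bracket \<alpha> \<beta> a b = a ** b - (-1) ^ (\<alpha> * \<beta>) *\<^sub>C (b ** a)"

definition gl_proj :: "nat \<Rightarrow> gl11 \<Rightarrow> gl11" where
  "gl_proj \<alpha> a = (\<chi> i j. if \<alpha> = (if i = j then 0 else 1) then a $ i $ j else 0)"

definition e_gl :: gl11 where "e_gl = vector [vector [0, 1], vector [0, 0]]"
definition f_gl :: gl11 where "f_gl = vector [vector [0, 0], vector [1, 0]]"
definition h1_gl :: gl11 where "h1_gl = vector [vector [1, 0], vector [0, 0]]"
definition h2_gl :: gl11 where "h2_gl = vector [vector [0, 0], vector [0, 1]]"

section \<open>Modules\<close>

text \<open>Modules are Z/2Z-graded, and so are submodules. The homogeneous components are subsets of a possibly larger ambient vector space; the
  action is only meaningful on their sum.\<close>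

record 'v gl_module =
  part :: "nat \<Rightarrow> 'v set"
  act :: "gl11 \<Rightarrow> 'v \<Rightarrow> 'v"

definition carrier :: "'v::complex_vector gl_module \<Rightarrow> 'v set" where
  "carrier M = {u + v | u v. u \<in> part M 0 \<and> v \<in> part M 1}"

definition is_module :: "'v::complex_vector gl_module \<Rightarrow> bool" where
  "is_module M \<longleftrightarrow>
     cvec.subspace (part M 0) \<and> cvec.subspace (part M 1) \<and> part M 0 \<inter> part M 1 = {0} \<and>
     (\<forall>\<alpha>\<in>{0,1}. \<forall>\<beta>\<in>{0,1}. \<forall>a\<in>gl_part \<alpha>. \<forall>v\<in>part M \<beta>. act M a v \<in> part M ((\<alpha> + \<beta>) mod 2)) \<and>
     (\<forall>a. \<forall>u\<in>carrier M. \<forall>v\<in>carrier M. act M a (u + v) = act M a u + act M a v) \<and>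
     (\<forall>a c. \<forall>v\<in>carrier M. act M a (c *\<^sub>C v) = c *\<^sub>C act M a v) \<and>
     (\<forall>a b. \<forall>v\<in>carrier M. act M (a + b) v = act M a v + act M b v) \<and>
     (\<forall>a c. \<forall>v\<in>carrier M. act M (c *\<^sub>C a) v = c *\<^sub>C act M a v) \<and>
     (\<forall>\<alpha>\<in>{0,1}. \<forall>\<beta>\<in>{0,1}. \<forall>a\<in>gl_part \<alpha>. \<forall>b\<in>gl_part \<beta>. \<forall>v\<in>carrier M.
        act M (bracket \<alpha> \<beta> a b) v =
          act M a (act M b v) - (-1) ^ (\<alpha> * \<beta>) *\<^sub>C act M b (act M a v))"

definition submodule :: "'v::complex_vector gl_module \<Rightarrow> 'v set \<Rightarrow> bool" where
  "submodule M W \<longleftrightarrow>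
     is_module M \<and> cvec.subspace W \<and>
     W = {u + v | u v. u \<in> W \<inter> part M 0 \<and> v \<in> W \<inter> part M 1} \<and>
     (\<forall>a. \<forall>w\<in>W. act M a w \<in> W)"

definition irreducible_module :: "'v::complex_vector gl_module \<Rightarrow> bool" where
  "irreducible_module M \<longleftrightarrow>
     is_module M \<and> carrier M \<noteq> {0} \<and> (\<forall>W. submodule M W \<longrightarrow> W = {0} \<or> W = carrier M)"

definition finite_dim :: "'v::complex_vector gl_module \<Rightarrow> bool" where
  "finite_dim M \<longleftrightarrow> (\<exists>B. finite B \<and> carrier M = cvec.span B)"

text \<open>Isomorphisms need not preserve the homogeneous components.\<close>

definition module_iso :: "'v::complex_vector gl_module \<Rightarrow> 'w::complex_vector gl_module \<Rightarrow> bool"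
    (infix \<open>\<cong>\<^sub>g\<close> 50) where
  "M \<cong>\<^sub>g N \<longleftrightarrow> is_module M \<and> is_module N \<and>
     (\<exists>\<phi>. bij_betw \<phi> (carrier M) (carrier N) \<and>
        (\<forall>u\<in>carrier M. \<forall>v\<in>carrier M. \<phi> (u + v) = \<phi> u + \<phi> v) \<and>
        (\<forall>c. \<forall>v\<in>carrier M. \<phi> (c *\<^sub>C v) = c *\<^sub>C \<phi> v) \<and>
        (\<forall>a. \<forall>v\<in>carrier M. \<phi> (act M a v) = act N a (\<phi> v)))"

definition internal_direct_sum ::
    "'v::complex_vector gl_module \<Rightarrow> 's set \<Rightarrow> ('s \<Rightarrow> 'v set) \<Rightarrow> bool" where
  "internal_direct_sum M S W \<longleftrightarrow>
     finite S \<and> (\<forall>s\<in>S. submodule M (W s)) \<and>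
     (\<forall>v\<in>carrier M. \<exists>!w. w \<in> (\<Pi>\<^sub>E s\<in>S. W s) \<and> v = (\<Sum>s\<in>S. w s))"

definition direct_sum :: "'j set \<Rightarrow> ('j \<Rightarrow> 'v::complex_vector gl_module) \<Rightarrow> ('j \<Rightarrow> 'v) gl_module" where
  "direct_sum J M =
     \<lparr> part = (\<lambda>\<alpha>. {f. finite {j. f j \<noteq> 0} \<and> (\<forall>j\<in>J. f j \<in> part (M j) \<alpha>) \<and> (\<forall>j. j \<notin> J \<longrightarrow> f j = 0)}),
       act = (\<lambda>a f j. if j \<in> J then act (M j) a (f j) else 0) \<rparr>"

definition highest_weight_vector ::
    "'v::complex_vector gl_module \<Rightarrow> int \<Rightarrow> int \<Rightarrow> 'v \<Rightarrow> bool" where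
  "highest_weight_vector M m n w \<longleftrightarrow>
     w \<in> carrier M \<and> w \<noteq> 0 \<and> act M e_gl w = 0 \<and>
     act M h1_gl w = of_int m *\<^sub>C w \<and> act M h2_gl w = of_int n *\<^sub>C w"

definition is_L :: "int \<Rightarrow> int \<Rightarrow> 'v::complex_vector gl_module \<Rightarrow> bool" where
  "is_L m n M \<longleftrightarrow>
     finite_dim M \<and> irreducible_module M \<and> (\<exists>w. highest_weight_vector M m n w)"

text \<open>Every finite-dimensional module is isomorphic to one whose underlying space is a subspace of
  \<^typ>\<open>nat \<Rightarrow> complex\<close>, so choosing a representative there is no restriction.\<close>

definition L :: "int \<Rightarrow> int \<Rightarrow> (nat \<Rightarrow> complex) gl_module" where
  "L m n = (SOME M. is_L m n M)"

section \<open>Tensor powers of the natural module\<close>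

definition x_vec :: "complex^2" where "x_vec = vector [1, 0]"
definition y_vec :: "complex^2" where "y_vec = vector [0, 1]"

text \<open>The basis vector \<^term>\<open>axis 1 1 = x_vec\<close> is even, \<^term>\<open>axis 2 1 = y_vec\<close> is odd.\<close>

definition parity :: "2 \<Rightarrow> nat" where
  "parity i = (if i = 1 then 0 else 1)"

definition V_part :: "nat \<Rightarrow> (complex^2) set" where
  "V_part \<beta> = {v. \<forall>i. v $ i \<noteq> 0 \<longrightarrow> parity i = \<beta>}"

text \<open>An element of the \<open>k\<close>-th tensor power is given by its coordinates in the basis of pure tensors
  of basis vectors: a function on index lists, supported on the lists of length \<open>k\<close>.\<close>

type_synonym tensor = "2 list \<Rightarrow> complex"

definition tensor_one :: tensor where
  "tensor_one is = (if is = [] then 1 else 0)"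

definition tensor_prod :: "complex^2 \<Rightarrow> tensor \<Rightarrow> tensor"  (infixr \<open>\<otimes>\<^sub>t\<close> 76) where
  "v \<otimes>\<^sub>t t = (\<lambda>is. case is of [] \<Rightarrow> 0 | i # js \<Rightarrow> v $ i * t js)"

primrec pure_tensor :: "(complex^2) list \<Rightarrow> tensor" where
  "pure_tensor [] = tensor_one"
| "pure_tensor (v # vs) = v \<otimes>\<^sub>t pure_tensor vs"

text \<open>A tensor \<open>t\<close> of order \<open>k + 1\<close> is the sum over \<open>i\<close> of
  \<^term>\<open>axis i 1 \<otimes>\<^sub>t (\<lambda>js. t (i # js))\<close>. The action is the linear extension, also in \<open>a\<close>, of the rule
  proved as \<open>tensor_act_prod\<close> below.\<close>

primrec tensor_act :: "nat \<Rightarrow> gl11 \<Rightarrow> tensor \<Rightarrow> tensor" where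
  "tensor_act 0 a t = 0"
| "tensor_act (Suc k) a t =
     (\<Sum>i\<in>UNIV. (a *v axis i 1) \<otimes>\<^sub>t (\<lambda>js. t (i # js)) +
       (\<Sum>\<alpha>\<in>{0,1}. (-1) ^ (\<alpha> * parity i) *\<^sub>C
          (axis i 1 \<otimes>\<^sub>t tensor_act k (gl_proj \<alpha> a) (\<lambda>js. t (i # js)))))"

definition tensor_power :: "nat \<Rightarrow> tensor gl_module" where
  "tensor_power k =
     \<lparr> part = (\<lambda>\<alpha>. {t. \<forall>is. t is \<noteq> 0 \<longrightarrow> length is = k \<and> (\<Sum>i\<leftarrow>is. parity i) mod 2 = \<alpha>}),
       act = tensor_act k \<rparr>"

definition u_list :: "nat \<Rightarrow> nat set \<Rightarrow> (complex^2) list" where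
  "u_list k s = map (\<lambda>i. if i \<in> s then x_vec else y_vec) [1..<k]"

definition v_sub :: "nat \<Rightarrow> nat set \<Rightarrow> tensor" where
  "v_sub k s = act (tensor_power k) e_gl (y_vec \<otimes>\<^sub>t pure_tensor (u_list k s))"

definition V_sub :: "nat \<Rightarrow> nat set \<Rightarrow> tensor set" where
  "V_sub k s = cvec.span {v_sub k s, act (tensor_power k) f_gl (v_sub k s)}"

lemma tensor_prod_simps [simp]:
  "(v \<otimes>\<^sub>t t) [] = 0" "(v \<otimes>\<^sub>t t) (i # js) = v $ i * t js"
  by (simp_all add: tensor_prod_def)

lemma tensor_act_Suc_apply:
  "tensor_act (Suc k) a t [] = 0"
  "tensor_act (Suc k) a t (i # js) =
     (\<Sum>l\<in>UNIV. a $ i $ l * t (l # js)) + tensor_act k (gl_proj 0 a) (\<lambda>js. t (i # js)) js +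
       (-1) ^ parity i * tensor_act k (gl_proj 1 a) (\<lambda>js. t (i # js)) js"
  using exhaust_2[of i]
  by (auto simp: sum_2 scaleC_fun_def scaleC_complex_def axis_def matrix_vector_mult_def
      algebra_simps)

lemma tensor_act_zero: "tensor_act k 0 t = 0"
proof (induction k arbitrary: t)
  case (Suc k)
  have [simp]: "gl_proj \<alpha> 0 = 0" for \<alpha> by (simp add: gl_proj_def vec_eq_iff)
  show ?case
  proof
    fix js show "tensor_act (Suc k) 0 t js = 0 js"
      by (cases js) (simp_all add: tensor_act_Suc_apply Suc.IH del: tensor_act.simps)
  qed
qed simp

lemma tensor_act_scale: "tensor_act k a (\<lambda>js. c * t js) js = c * tensor_act k a t js"
proof (induction k arbitrary: a t js)
  case (Suc k)
  then show ?case
    by (cases js) (simp_all add: tensor_act_Suc_apply sum_2 algebra_simps del: tensor_act.simps)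
qed simp

lemma tensor_act_scale': "tensor_act k a (\<lambda>js. t js * c) js = c * tensor_act k a t js"
  using tensor_act_scale[of k a c t js] by (simp add: mult.commute)

lemma tensor_act_zero_right: "tensor_act k a (\<lambda>js. 0) js = 0"
  using tensor_act_scale[of k a 0 "\<lambda>js. 0" js] by simp

lemma tensor_act_prod:
  assumes "\<alpha> \<in> {0,1}" "\<beta> \<in> {0,1}" "a \<in> gl_part \<alpha>" "v \<in> V_part \<beta>"
  shows "tensor_act (Suc k) a (v \<otimes>\<^sub>t t) =
           (a *v v) \<otimes>\<^sub>t t + (-1) ^ (\<alpha> * \<beta>) *\<^sub>C (v \<otimes>\<^sub>t tensor_act k a t)"
proof
  fix js
  have p: "gl_proj \<gamma> a = (if \<gamma> = \<alpha> then a else 0)" if "\<gamma> \<in> {0,1}" for \<gamma>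
    using assms(1,3) that by (auto simp: gl_proj_def gl_part_def vec_eq_iff split: if_splits)
  have v: "v $ i = 0 \<or> parity i = \<beta>" for i
    using assms(4) by (auto simp: V_part_def)
  show "tensor_act (Suc k) a (v \<otimes>\<^sub>t t) js =
          ((a *v v) \<otimes>\<^sub>t t + (-1) ^ (\<alpha> * \<beta>) *\<^sub>C (v \<otimes>\<^sub>t tensor_act k a t)) js"
  proof (cases js)
    case (Cons i js)
    then show ?thesis
      using assms(1,2) v[of i]
      by (auto simp: tensor_act_Suc_apply p tensor_act_zero tensor_act_scale' tensor_act_zero_right scaleC_fun_def
          scaleC_complex_def matrix_vector_mult_def sum_2 algebra_simps
          simp del: tensor_act.simps)
  qed (simp add: tensor_act_Suc_apply scaleC_fun_def scaleC_complex_def del: tensor_act.simps)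
qed

end

theory Submission
  imports Defs
begin

text \<open>
  Everything rests on the relation \<open>e f + f e = h\<^sub>1 + h\<^sub>2\<close>. Each basis tensor of \<open>V\<^sup>\<otimes>\<^sup>k\<close> has \<open>k\<close> factors,
  each of weight \<open>[1,0]\<close> or \<open>[0,1]\<close>, so \<open>h\<^sub>1 + h\<^sub>2\<close> acts on the tensor power as the scalar \<open>k\<close>, which is
  not zero (\<open>tensor_power_e_f\<close>). Hence \<open>t = (1/k) (e f t + f e t)\<close> for every tensor \<open>t\<close>, and a basis of
  the image of \<open>e\<close> together with its image under \<open>f\<close> spans the whole space. It is linearly
  independent too, because \<open>e t\<close> and \<open>e f t\<close> recover the two families of coefficients.

  The vectors \<open>v\<^sub>s\<close> are a basis of the image of \<open>e\<close>. Write \<open>z = e t\<close> as \<open>x \<otimes> z\<^sub>x + y \<otimes> z\<^sub>y\<close>. Since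
  \<open>e\<^sup>2 = 0\<close>, the part \<open>z\<^sub>x\<close> determines \<open>z\<close> (\<open>image_e_determined\<close>). For \<open>z = v\<^sub>s\<close> this part is the basis
  tensor \<open>u\<^sub>s\<close>, so the coefficient of \<open>v\<^sub>s\<close> in \<open>z\<close> is just the coordinate of \<open>z\<close> at \<open>x \<otimes> u\<^sub>s\<close>
  (\<open>image_e_expansion\<close>). This proves the internal decomposition, with explicit coefficients.

  For the second decomposition, let \<open>v\<close> be a homogeneous highest weight vector of weight \<open>[m,n]\<close> with
  \<open>m + n \<noteq> 0\<close>. Then \<open>v\<close> and \<open>f v\<close> are independent, they span a submodule, and the matrices of the action
  on this span depend on \<open>m\<close> and \<open>n\<close> alone (\<open>act_hw_comb\<close>); so any two such spans are isomorphic. Both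
  \<open>V\<^sub>s\<close> and \<open>L[|s|+1, k-1-|s|]\<close> have this form, the weights adding up to \<open>k\<close>. It remains to count the
  subsets \<open>s\<close> of each size.
\<close>

section \<open>Matrices in gl(1|1)\<close>

lemma unit_entries [simp]:
  "e_gl $ 1 $ 1 = 0" "e_gl $ 1 $ 2 = 1" "e_gl $ 2 $ 1 = 0" "e_gl $ 2 $ 2 = 0"
  "f_gl $ 1 $ 1 = 0" "f_gl $ 1 $ 2 = 0" "f_gl $ 2 $ 1 = 1" "f_gl $ 2 $ 2 = 0"
  "h1_gl $ 1 $ 1 = 1" "h1_gl $ 1 $ 2 = 0" "h1_gl $ 2 $ 1 = 0" "h1_gl $ 2 $ 2 = 0"
  "h2_gl $ 1 $ 1 = 0" "h2_gl $ 1 $ 2 = 0" "h2_gl $ 2 $ 1 = 0" "h2_gl $ 2 $ 2 = 1"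
  by (simp_all add: e_gl_def f_gl_def h1_gl_def h2_gl_def)

lemma scaleC_entry [simp]: "(c *\<^sub>C (a::gl11)) $ i $ j = c * a $ i $ j"
  by (simp add: scaleC_vec_def scaleC_complex_def)

lemma gl_eq_iff:
  "(a::gl11) = b \<longleftrightarrow> a$1$1 = b$1$1 \<and> a$1$2 = b$1$2 \<and> a$2$1 = b$2$1 \<and> a$2$2 = b$2$2"
  by (auto simp: vec_eq_iff forall_2)

lemma gl_mult_entry: "((a::gl11) ** b) $ i $ j = a$i$1 * b$1$j + a$i$2 * b$2$j"
  by (simp add: matrix_matrix_mult_def sum_2)

lemma unit_degrees:
  "e_gl \<in> gl_part 1" "f_gl \<in> gl_part 1" "h1_gl \<in> gl_part 0" "h2_gl \<in> gl_part 0"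
  by (simp_all add: gl_part_def forall_2)

lemma gl_part_0_iff: "a \<in> gl_part 0 \<longleftrightarrow> a$1$2 = 0 \<and> a$2$1 = 0"
  and gl_part_1_iff: "a \<in> gl_part (Suc 0) \<longleftrightarrow> a$1$1 = 0 \<and> a$2$2 = 0"
  by (auto simp: gl_part_def forall_2)

lemma unit_brackets:
  "bracket 1 1 e_gl e_gl = 0" "bracket 1 1 f_gl f_gl = 0"
  "bracket 1 1 e_gl f_gl = h1_gl + h2_gl"
  "bracket 0 1 h1_gl e_gl = e_gl" "bracket 0 1 h2_gl e_gl = (-1) *\<^sub>C e_gl"
  "bracket 0 1 h1_gl f_gl = (-1) *\<^sub>C f_gl" "bracket 0 1 h2_gl f_gl = f_gl"
  by (simp_all add: gl_eq_iff bracket_def gl_mult_entry)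

lemma gl_basis_expansion:
  "a = a$1$1 *\<^sub>C h1_gl + a$2$2 *\<^sub>C h2_gl + a$1$2 *\<^sub>C e_gl + a$2$1 *\<^sub>C f_gl"
  by (simp add: gl_eq_iff)

lemma gl_proj_entries [simp]:
  "gl_proj 0 a $ 1 $ 1 = a $ 1 $ 1" "gl_proj 0 a $ 2 $ 2 = a $ 2 $ 2"
  "gl_proj 0 a $ 1 $ 2 = 0" "gl_proj 0 a $ 2 $ 1 = 0"
  "gl_proj (Suc 0) a $ 1 $ 1 = 0" "gl_proj (Suc 0) a $ 2 $ 2 = 0"
  "gl_proj (Suc 0) a $ 1 $ 2 = a $ 1 $ 2" "gl_proj (Suc 0) a $ 2 $ 1 = a $ 2 $ 1"
  by (simp_all add: gl_proj_def)

section \<open>Elementary properties of modules\<close>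

locale gl11_module =
  fixes M :: "'v::complex_vector gl_module"
  assumes is_module: "is_module M"
begin

lemma subspace_part: "p \<in> {0,1} \<Longrightarrow> cvec.subspace (part M p)"
  using is_module by (auto simp: is_module_def)

lemma part_Int: "part M 0 \<inter> part M 1 = {0}"
  using is_module by (auto simp: is_module_def)

lemmas conditions = is_module[unfolded is_module_def, THEN conjunct2, THEN conjunct2, THEN conjunct2]

lemma act_part:
  "\<lbrakk>\<alpha> \<in> {0,1}; \<beta> \<in> {0,1}; a \<in> gl_part \<alpha>; v \<in> part M \<beta>\<rbrakk>
    \<Longrightarrow> act M a v \<in> part M ((\<alpha> + \<beta>) mod 2)"
  by (rule conditions[THEN conjunct1, rule_format])

lemma act_add: "\<lbrakk>u \<in> carrier M; v \<in> carrier M\<rbrakk> \<Longrightarrow> act M a (u + v) = act M a u + act M a v"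
  and act_scale: "v \<in> carrier M \<Longrightarrow> act M a (c *\<^sub>C v) = c *\<^sub>C act M a v"
  and act_add_left: "v \<in> carrier M \<Longrightarrow> act M (a + b) v = act M a v + act M b v"
  and act_scale_left: "v \<in> carrier M \<Longrightarrow> act M (c *\<^sub>C a) v = c *\<^sub>C act M a v"
  using conditions by (elim conjE, simp)+

lemma act_bracket:
  "\<lbrakk>\<alpha> \<in> {0,1}; \<beta> \<in> {0,1}; a \<in> gl_part \<alpha>; b \<in> gl_part \<beta>; v \<in> carrier M\<rbrakk>
    \<Longrightarrow> act M (bracket \<alpha> \<beta> a b) v =
          act M a (act M b v) - (-1) ^ (\<alpha> * \<beta>) *\<^sub>C act M b (act M a v)"
  by (rule conditions[THEN conjunct2, THEN conjunct2, THEN conjunct2, THEN conjunct2,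
        THEN conjunct2, rule_format])

lemma subspace_carrier: "cvec.subspace (carrier M)"
  using cvec.subspace_sums[OF subspace_part subspace_part, of 0 1]
  by (simp add: carrier_def)

lemma part_subset_carrier:
  assumes "p \<in> {0,1}" shows "part M p \<subseteq> carrier M"
proof
  fix u assume u: "u \<in> part M p"
  have "0 \<in> part M 0" "0 \<in> part M 1"
    by (simp_all add: cvec.subspace_0 subspace_part)
  moreover have "u = u + 0" "u = 0 + u" by simp_all
  ultimately show "u \<in> carrier M"
    using u assms unfolding carrier_def by blast
qed

text \<open>The degree condition only speaks of homogeneous arguments, so both the matrix and the vector have to
  be split into homogeneous parts.\<close>

lemma act_carrier:
  assumes "v \<in> carrier M" shows "act M a v \<in> carrier M"
proof -
  obtain v0 v1 where v: "v = v0 + v1" "v0 \<in> part M 0" "v1 \<in> part M 1"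
    using assms by (auto simp: carrier_def)
  have unit: "act M b u \<in> carrier M"
    if "b \<in> gl_part \<alpha>" "\<alpha> \<in> {0,1}" "u \<in> part M \<beta>" "\<beta> \<in> {0,1}" for b u \<alpha> \<beta>
    using act_part[of \<alpha> \<beta> b u] that part_subset_carrier[of "(\<alpha> + \<beta>) mod 2"] by auto
  have homogeneous: "act M a u \<in> carrier M" if u: "u \<in> part M \<beta>" "\<beta> \<in> {0,1}" for u \<beta>
  proof -
    have a: "a = gl_proj 0 a + gl_proj 1 a" by (simp add: gl_eq_iff)
    have proj: "gl_proj 0 a \<in> gl_part 0" "gl_proj 1 a \<in> gl_part 1"
      by (simp_all add: gl_part_0_iff gl_part_1_iff)
    have "u \<in> carrier M" using u part_subset_carrier by blast
    then have "act M a u = act M (gl_proj 0 a) u + act M (gl_proj 1 a) u"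
      using act_add_left[of u "gl_proj 0 a" "gl_proj 1 a"] a by simp
    also have "\<dots> \<in> carrier M"
      by (intro cvec.subspace_add[OF subspace_carrier] unit[OF proj(1) _ u] unit[OF proj(2) _ u])
        simp_all
    finally show ?thesis .
  qed
  have "v0 \<in> carrier M" "v1 \<in> carrier M"
    using v part_subset_carrier[of 0] part_subset_carrier[of 1] by auto
  then have "act M a v = act M a v0 + act M a v1" using v act_add by simp
  also have "\<dots> \<in> carrier M"
    using v by (intro cvec.subspace_add[OF subspace_carrier]) (auto intro: homogeneous)
  finally show ?thesis .
qed

lemma act_zero: "act M a 0 = 0"
  using act_scale[of 0 a 0] cvec.subspace_0[OF subspace_carrier] by simp

lemma act_zero_left: "v \<in> carrier M \<Longrightarrow> act M 0 v = 0"
  using act_scale_left[of v 0 0] by simp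

lemma act_sum:
  "(\<And>j. j \<in> J \<Longrightarrow> g j \<in> carrier M) \<Longrightarrow> act M a (\<Sum>j\<in>J. g j) = (\<Sum>j\<in>J. act M a (g j))"
proof (induction J rule: infinite_finite_induct)
  case (insert j J)
  then show ?case by (simp add: act_add cvec.subspace_sum[OF subspace_carrier])
qed (simp_all add: act_zero)

lemma act_basis_expansion:
  assumes "v \<in> carrier M"
  shows "act M a v = a$1$1 *\<^sub>C act M h1_gl v + a$2$2 *\<^sub>C act M h2_gl v
           + a$1$2 *\<^sub>C act M e_gl v + a$2$1 *\<^sub>C act M f_gl v"
  by (subst gl_basis_expansion[of a]) (simp only: act_add_left act_scale_left assms)

text \<open>The bracket of odd elements is the anticommutator, so \<open>[a,a] = 2 a\<^sup>2\<close>.\<close>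

lemma odd_square_zero:
  assumes "a \<in> gl_part 1" "bracket 1 1 a a = 0" "v \<in> carrier M"
  shows "act M a (act M a v) = 0"
proof -
  have "act M a (act M a v) - (-1) *\<^sub>C act M a (act M a v) = 0"
    using act_bracket[of 1 1 a a v] assms by (simp add: act_zero_left)
  then have "(1 - (-1)) *\<^sub>C act M a (act M a v) = 0"
    by (simp only: cvec.scale_left_diff_distrib cvec.scale_one)
  then show ?thesis by (simp add: cvec.scale_eq_0_iff)
qed

lemma e_e: "v \<in> carrier M \<Longrightarrow> act M e_gl (act M e_gl v) = 0"
  and f_f: "v \<in> carrier M \<Longrightarrow> act M f_gl (act M f_gl v) = 0"
  using odd_square_zero unit_degrees unit_brackets by blast+

lemma e_f:
  assumes "v \<in> carrier M"
  shows "act M e_gl (act M f_gl v) = act M h1_gl v + act M h2_gl v - act M f_gl (act M e_gl v)"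
  using act_bracket[of 1 1 e_gl f_gl v] unit_degrees assms
  by (simp add: unit_brackets[simplified] act_add_left algebra_simps)

lemma h_commutation:
  assumes "v \<in> carrier M"
  shows "act M h1_gl (act M e_gl v) = act M e_gl (act M h1_gl v) + act M e_gl v"
    and "act M h2_gl (act M e_gl v) = act M e_gl (act M h2_gl v) - act M e_gl v"
    and "act M h1_gl (act M f_gl v) = act M f_gl (act M h1_gl v) - act M f_gl v"
    and "act M h2_gl (act M f_gl v) = act M f_gl (act M h2_gl v) + act M f_gl v"
  using act_bracket[of 0 1 h1_gl e_gl v] act_bracket[of 0 1 h2_gl e_gl v]
    act_bracket[of 0 1 h1_gl f_gl v] act_bracket[of 0 1 h2_gl f_gl v] unit_degrees assms
    act_scale_left[of v "-1" e_gl] act_scale_left[of v "-1" f_gl]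
  by (simp_all add: unit_brackets[simplified] algebra_simps)

end

section \<open>The submodule generated by a highest weight vector\<close>

text \<open>The action of \<open>a\<close> in coordinates with respect to \<open>v\<close> and \<open>f v\<close>, for a highest weight vector \<open>v\<close> of
  weight \<open>[m,n]\<close>.\<close>

definition typical_act :: "complex \<Rightarrow> complex \<Rightarrow> gl11 \<Rightarrow> complex \<times> complex \<Rightarrow> complex \<times> complex" where
  "typical_act m n a z =
     ((a$1$1 * m + a$2$2 * n) * fst z + a$1$2 * (m + n) * snd z,
      a$2$1 * fst z + (a$1$1 * (m - 1) + a$2$2 * (n + 1)) * snd z)"

definition hw_comb :: "'v::complex_vector gl_module \<Rightarrow> 'v \<Rightarrow> complex \<times> complex \<Rightarrow> 'v" where
  "hw_comb M v z = fst z *\<^sub>C v + snd z *\<^sub>C act M f_gl v"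

lemma hw_comb_add: "hw_comb M v (z + z') = hw_comb M v z + hw_comb M v z'"
  by (simp add: hw_comb_def scaleC_add_left)

lemma hw_comb_scale: "hw_comb M v (c * fst z, c * snd z) = c *\<^sub>C hw_comb M v z"
  by (simp add: hw_comb_def scaleC_add_right scaleC_scaleC)

lemma hw_comb_diff: "hw_comb M v (z - z') = hw_comb M v z - hw_comb M v z'"
  by (simp add: hw_comb_def cvec.scale_left_diff_distrib)

lemma range_hw_comb: "range (hw_comb M v) = cvec.span {v, act M f_gl v}"
proof (intro equalityI subsetI)
  fix u assume "u \<in> range (hw_comb M v)"
  then obtain z where "u = fst z *\<^sub>C v + snd z *\<^sub>C act M f_gl v"
    unfolding hw_comb_def by blast
  then show "u \<in> cvec.span {v, act M f_gl v}"
    by (simp add: cvec.span_add cvec.span_scale cvec.span_base)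
next
  fix u assume "u \<in> cvec.span {v, act M f_gl v}"
  then obtain c where "u - c *\<^sub>C v \<in> cvec.span {act M f_gl v}"
    by (auto simp: cvec.span_insert[of v])
  then obtain d where "u - c *\<^sub>C v = d *\<^sub>C act M f_gl v"
    by (auto simp: cvec.span_singleton)
  then have "u = hw_comb M v (c, d)" by (simp add: hw_comb_def algebra_simps)
  then show "u \<in> range (hw_comb M v)" by blast
qed

text \<open>A highest weight vector is called typical if \<open>m + n \<noteq> 0\<close>; this keeps \<open>f v\<close> from vanishing, because
  \<open>e f v = (m + n) v\<close>. Homogeneity of \<open>v\<close> makes the span of \<open>v\<close> and \<open>f v\<close> a graded subspace.\<close>

locale typical_highest_weight = gl11_module +
  fixes p :: nat and m n :: complex and v
  assumes p: "p \<in> {0,1}"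
    and homogeneous: "v \<in> part M p"
    and nonzero: "v \<noteq> 0"
    and e_v: "act M e_gl v = 0"
    and h1_v: "act M h1_gl v = m *\<^sub>C v"
    and h2_v: "act M h2_gl v = n *\<^sub>C v"
    and typical: "m + n \<noteq> 0"
begin

lemma v_carrier: "v \<in> carrier M"
  using homogeneous part_subset_carrier p by blast

lemma fv_carrier: "act M f_gl v \<in> carrier M"
  by (rule act_carrier[OF v_carrier])

lemma fv_part: "act M f_gl v \<in> part M ((1 + p) mod 2)"
  using act_part[OF _ p unit_degrees(2) homogeneous] by simp

lemma hw_comb_carrier: "hw_comb M v z \<in> carrier M"
  unfolding hw_comb_def
  by (intro cvec.subspace_add[OF subspace_carrier] cvec.subspace_scale[OF subspace_carrier]
      v_carrier fv_carrier)

lemma act_hw_comb: "act M a (hw_comb M v z) = hw_comb M v (typical_act m n a z)"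
proof -
  have fv: "act M e_gl (act M f_gl v) = (m + n) *\<^sub>C v"
    "act M h1_gl (act M f_gl v) = (m - 1) *\<^sub>C act M f_gl v"
    "act M h2_gl (act M f_gl v) = (n + 1) *\<^sub>C act M f_gl v"
    "act M f_gl (act M f_gl v) = 0"
    by (simp_all add: e_f h_commutation f_f v_carrier e_v h1_v h2_v act_zero act_scale
        scaleC_add_left cvec.scale_left_diff_distrib scaleC_one)
  have "act M a (hw_comb M v z) = fst z *\<^sub>C act M a v + snd z *\<^sub>C act M a (act M f_gl v)"
    unfolding hw_comb_def
    by (simp add: act_add act_scale v_carrier fv_carrier cvec.subspace_scale[OF subspace_carrier])
  also have "\<dots> = hw_comb M v (typical_act m n a z)"
    unfolding act_basis_expansion[OF v_carrier, of a] act_basis_expansion[OF fv_carrier, of a]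
    by (simp add: fv e_v h1_v h2_v hw_comb_def typical_act_def scaleC_add_left scaleC_add_right
        scaleC_scaleC cvec.scale_left_diff_distrib cvec.scale_right_diff_distrib algebra_simps)
  finally show ?thesis .
qed

text \<open>Applying \<open>e\<close> kills \<open>v\<close> and turns \<open>f v\<close> into the nonzero multiple \<open>(m + n) v\<close>, which isolates the second
  coefficient.\<close>

lemma hw_comb_eq_0: "hw_comb M v z = 0 \<Longrightarrow> z = 0"
proof -
  assume z: "hw_comb M v z = 0"
  have "act M e_gl (hw_comb M v z) = ((m + n) * snd z) *\<^sub>C v"
    by (simp only: act_hw_comb) (simp add: typical_act_def hw_comb_def)
  then have "snd z = 0" using z typical nonzero by (simp add: act_zero cvec.scale_eq_0_iff)
  moreover from this have "fst z = 0" using z nonzero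
    by (simp add: hw_comb_def cvec.scale_eq_0_iff)
  ultimately show "z = 0" by (simp add: prod_eq_iff)
qed

lemma inj_hw_comb: "inj (hw_comb M v)"
proof (rule injI)
  fix z z' assume "hw_comb M v z = hw_comb M v z'"
  then have "z - z' = 0" by (intro hw_comb_eq_0) (simp add: hw_comb_diff)
  then show "z = z'" by simp
qed

lemma submodule_span: "submodule M (cvec.span {v, act M f_gl v})" (is "submodule M ?W")
proof -
  have W: "cvec.subspace ?W" by (rule cvec.subspace_span)
  have "u \<in> {u + v | u v. u \<in> ?W \<inter> part M 0 \<and> v \<in> ?W \<inter> part M 1}" if "u \<in> ?W" for u
  proof -
    obtain z where z: "u = fst z *\<^sub>C v + snd z *\<^sub>C act M f_gl v"
      using \<open>u \<in> ?W\<close> unfolding range_hw_comb[symmetric] hw_comb_def by blast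
    have in_W: "fst z *\<^sub>C v \<in> ?W" "snd z *\<^sub>C act M f_gl v \<in> ?W"
      by (auto intro: cvec.span_scale cvec.span_base)
    have "fst z *\<^sub>C v \<in> part M p" "snd z *\<^sub>C act M f_gl v \<in> part M ((1 + p) mod 2)"
      using p homogeneous fv_part by (auto intro: cvec.subspace_scale[OF subspace_part])
    moreover have "x + y \<in> {u + v | u v. u \<in> ?W \<inter> part M 0 \<and> v \<in> ?W \<inter> part M 1}"
      if "x \<in> ?W" "y \<in> ?W" "x \<in> part M 0" "y \<in> part M 1" for x y
      using that by blast
    ultimately show ?thesis
      using p z in_W by (cases "p = 0") (simp_all, metis add.commute)
  qed
  moreover have "u + v \<in> ?W" if "u \<in> ?W" "v \<in> ?W" for u v
    using cvec.subspace_add[OF W] that .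
  ultimately have "?W = {u + v | u v. u \<in> ?W \<inter> part M 0 \<and> v \<in> ?W \<inter> part M 1}"
    by blast
  moreover have "act M a u \<in> ?W" if "u \<in> ?W" for a u
    using that act_hw_comb unfolding range_hw_comb[symmetric] by auto
  ultimately show ?thesis using is_module W by (auto simp: submodule_def)
qed

end


text \<open>Stated for subspaces of the carriers, so that it applies to a submodule such as \<open>V\<^sub>s\<close> without turning
  that subspace into a module of its own.\<close>

definition equivariant_iso ::
  "'v::complex_vector gl_module \<Rightarrow> 'v set \<Rightarrow> 'w::complex_vector gl_module \<Rightarrow> 'w set \<Rightarrow> ('v \<Rightarrow> 'w) \<Rightarrow> bool"
where
  "equivariant_iso M A N B \<phi> \<longleftrightarrow> bij_betw \<phi> A B \<and>
     (\<forall>u\<in>A. \<forall>v\<in>A. \<phi> (u + v) = \<phi> u + \<phi> v) \<and>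
     (\<forall>c. \<forall>v\<in>A. \<phi> (c *\<^sub>C v) = c *\<^sub>C \<phi> v) \<and>
     (\<forall>a. \<forall>v\<in>A. \<phi> (act M a v) = act N a (\<phi> v))"

lemma module_iso_iff:
  "M \<cong>\<^sub>g N \<longleftrightarrow> is_module M \<and> is_module N \<and> (\<exists>\<phi>. equivariant_iso M (carrier M) N (carrier N) \<phi>)"
  by (simp add: module_iso_def equivariant_iso_def)

lemma equivariant_isoI:
  assumes "bij_betw \<phi> A B"
    and "\<And>u v. u \<in> A \<Longrightarrow> v \<in> A \<Longrightarrow> \<phi> (u + v) = \<phi> u + \<phi> v"
    and "\<And>c v. v \<in> A \<Longrightarrow> \<phi> (c *\<^sub>C v) = c *\<^sub>C \<phi> v"
    and "\<And>a v. v \<in> A \<Longrightarrow> \<phi> (act M a v) = act N a (\<phi> v)"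
  shows "equivariant_iso M A N B \<phi>"
  using assms by (simp add: equivariant_iso_def)

lemma equivariant_isoD:
  assumes "equivariant_iso M A N B \<phi>"
  shows "bij_betw \<phi> A B"
    and "u \<in> A \<Longrightarrow> v \<in> A \<Longrightarrow> \<phi> (u + v) = \<phi> u + \<phi> v"
    and "v \<in> A \<Longrightarrow> \<phi> (c *\<^sub>C v) = c *\<^sub>C \<phi> v"
    and "v \<in> A \<Longrightarrow> \<phi> (act M a v) = act N a (\<phi> v)"
  using assms by (simp_all add: equivariant_iso_def)

lemma equivariant_iso_sym:
  assumes \<phi>: "equivariant_iso M A N B \<phi>"
    and A: "cvec.subspace A" and closed: "\<And>a v. v \<in> A \<Longrightarrow> act M a v \<in> A"
  shows "equivariant_iso N B M A (inv_into A \<phi>)"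
proof (rule equivariant_isoI)
  note bij = equivariant_isoD(1)[OF \<phi>]
  let ?\<psi> = "inv_into A \<phi>"
  have \<psi>: "?\<psi> u \<in> A" "\<phi> (?\<psi> u) = u" if "u \<in> B" for u
    using that bij by (auto simp: bij_betw_def inv_into_into f_inv_into_f)
  have left: "?\<psi> (\<phi> v) = v" if "v \<in> A" for v
    using that bij by (simp add: bij_betw_def inv_into_f_f)
  show "bij_betw ?\<psi> B A" by (rule bij_betw_inv_into[OF bij])
  show "?\<psi> (u + v) = ?\<psi> u + ?\<psi> v" if "u \<in> B" "v \<in> B" for u v
    using left[of "?\<psi> u + ?\<psi> v"] \<psi> that cvec.subspace_add[OF A] equivariant_isoD(2)[OF \<phi>]
    by simp
  show "?\<psi> (c *\<^sub>C v) = c *\<^sub>C ?\<psi> v" if "v \<in> B" for c v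
    using left[of "c *\<^sub>C ?\<psi> v"] \<psi> that cvec.subspace_scale[OF A] equivariant_isoD(3)[OF \<phi>]
    by simp
  show "?\<psi> (act N a v) = act M a (?\<psi> v)" if "v \<in> B" for a v
    using left[of "act M a (?\<psi> v)"] \<psi> that closed equivariant_isoD(4)[OF \<phi>] by simp
qed

lemma module_iso_sym: "M \<cong>\<^sub>g N \<Longrightarrow> N \<cong>\<^sub>g M"
  unfolding module_iso_iff
  using equivariant_iso_sym gl11_module.subspace_carrier gl11_module.act_carrier gl11_module.intro
  by metis

text \<open>Sending \<open>\<alpha> v + \<beta> f v\<close> to \<open>\<alpha> w + \<beta> f w\<close> commutes with the action, because the coordinates of the action
  involve nothing but the common weight. The parities of \<open>v\<close> and \<open>w\<close> may differ.\<close>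

lemma typical_highest_weight_iso:
  assumes M: "typical_highest_weight M p m n v" and N: "typical_highest_weight N q m n w"
  obtains \<phi> where "equivariant_iso M (cvec.span {v, act M f_gl v})
    N (cvec.span {w, act N f_gl w}) \<phi>"
proof -
  interpret M: typical_highest_weight M p m n v by (rule M)
  interpret N: typical_highest_weight N q m n w by (rule N)
  define \<phi> where "\<phi> = hw_comb N w \<circ> inv (hw_comb M v)"
  have \<phi>: "\<phi> (hw_comb M v z) = hw_comb N w z" for z
    by (simp add: \<phi>_def inv_f_f[OF M.inj_hw_comb])
  have "equivariant_iso M (range (hw_comb M v)) N (range (hw_comb N w)) \<phi>"
  proof (rule equivariant_isoI)
    have "inj_on \<phi> (range (hw_comb M v))"
      by (rule inj_onI) (auto simp: \<phi> dest: injD[OF N.inj_hw_comb])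
    moreover have "\<phi> ` range (hw_comb M v) = range (hw_comb N w)"
      by (simp add: image_image \<phi>)
    ultimately show "bij_betw \<phi> (range (hw_comb M v)) (range (hw_comb N w))"
      by (simp add: bij_betw_def)
  qed (auto simp: \<phi> M.act_hw_comb N.act_hw_comb simp flip: hw_comb_add hw_comb_scale)
  then show ?thesis by (intro that) (simp add: range_hw_comb)
qed

section \<open>The irreducible modules L[m,n]\<close>

context typical_highest_weight
begin

text \<open>A nonzero submodule contains \<open>v\<close>: a vector with a nonzero \<open>f v\<close>-coefficient is mapped by \<open>e\<close> to a
  nonzero multiple of \<open>v\<close>, and otherwise it is such a multiple already.\<close>

lemma irreducible_if_generated:
  assumes gen: "carrier M = cvec.span {v, act M f_gl v}"
  shows "irreducible_module M"
  unfolding irreducible_module_def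
proof (intro conjI allI impI)
  show "is_module M" by (rule is_module)
  show "carrier M \<noteq> {0}" using v_carrier nonzero by blast
  fix W assume W: "submodule M W"
  have sub: "cvec.subspace W" and act_W: "\<And>a u. u \<in> W \<Longrightarrow> act M a u \<in> W"
    and "W = {u + v | u v. u \<in> W \<inter> part M 0 \<and> v \<in> W \<inter> part M 1}"
    using W by (simp_all add: submodule_def)
  then have W_carrier: "W \<subseteq> carrier M" unfolding carrier_def by blast
  show "W = {0} \<or> W = carrier M"
  proof (cases "W = {0}")
    case False
    then obtain u where u: "u \<in> W" "u \<noteq> 0" using cvec.subspace_0[OF sub] by blast
    obtain z where z: "u = hw_comb M v z"
      using u(1) W_carrier gen range_hw_comb[of M v] by blast
    have "v \<in> W"
    proof (cases "snd z = 0")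
      case True
      then have "u = fst z *\<^sub>C v" "fst z \<noteq> 0" using z u(2) by (auto simp: hw_comb_def)
      then have "v = inverse (fst z) *\<^sub>C u" by (simp add: scaleC_scaleC scaleC_one)
      then show ?thesis using cvec.subspace_scale[OF sub u(1)] by simp
    next
      case False
      have "act M e_gl u = ((m + n) * snd z) *\<^sub>C v"
        unfolding z act_hw_comb by (simp add: typical_act_def hw_comb_def)
      then have "v = inverse ((m + n) * snd z) *\<^sub>C act M e_gl u"
        using False typical by (simp add: scaleC_scaleC scaleC_one del: inverse_mult_distrib)
      then show ?thesis using cvec.subspace_scale[OF sub act_W[OF u(1)]] by metis
    qed
    then have "{v, act M f_gl v} \<subseteq> W" using act_W by blast
    then have "carrier M \<subseteq> W" unfolding gen by (rule cvec.span_minimal[OF _ sub])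
    then show ?thesis using W_carrier by blast
  qed simp
qed

end

text \<open>The highest weight vector provided by \<open>is_L\<close> can be a sum of an even and an odd vector. As \<open>h\<^sub>1\<close> and \<open>h\<^sub>2\<close>
  preserve the parity and \<open>e\<close> reverses it, both parts satisfy the same equations, and one of them is not
  zero. The submodule generated by that part is everything, by irreducibility.\<close>

lemma is_L_generated:
  assumes L: "is_L m n M" and mn: "m + n \<noteq> 0"
  obtains p v where "typical_highest_weight M p (of_int m) (of_int n) v"
    and "carrier M = cvec.span {v, act M f_gl v}"
proof -
  have irr: "irreducible_module M" using L by (simp add: is_L_def)
  interpret gl11_module M using irr by unfold_locales (simp add: irreducible_module_def)
  obtain w where w: "w \<in> carrier M" "w \<noteq> 0" "act M e_gl w = 0"
    "act M h1_gl w = of_int m *\<^sub>C w" "act M h2_gl w = of_int n *\<^sub>C w"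
    using L by (auto simp: is_L_def highest_weight_vector_def)
  obtain w0 w1 where w01: "w = w0 + w1" "w0 \<in> part M 0" "w1 \<in> part M 1"
    using w(1) by (auto simp: carrier_def)
  have w01_carrier: "w0 \<in> carrier M" "w1 \<in> carrier M"
    using w01 part_subset_carrier[of 0] part_subset_carrier[of 1] by auto
  \<comment> \<open>Comparison of homogeneous parts.\<close>
  have split: "x0 = y0 \<and> x1 = y1"
    if "x0 + x1 = y0 + y1" "x0 \<in> part M 0" "y0 \<in> part M 0" "x1 \<in> part M 1" "y1 \<in> part M 1"
    for x0 x1 y0 y1
  proof -
    have eq: "x0 - y0 = y1 - x1" using that(1) by (simp add: algebra_simps)
    have "x0 - y0 \<in> part M 0" "y1 - x1 \<in> part M 1"
      using that by (auto intro: cvec.subspace_diff[OF subspace_part])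
    then have "x0 - y0 \<in> part M 0 \<inter> part M 1" using eq by (metis IntI)
    then have "x0 - y0 = 0" unfolding part_Int by (rule singletonD)
    then show ?thesis using eq by simp
  qed
  have weight: "act M h w0 = c *\<^sub>C w0 \<and> act M h w1 = c *\<^sub>C w1"
    if "h \<in> gl_part 0" "act M h w = c *\<^sub>C w" for h c
  proof (rule split)
    show "act M h w0 + act M h w1 = c *\<^sub>C w0 + c *\<^sub>C w1"
      using that(2) by (simp add: w01(1) act_add w01_carrier scaleC_add_right)
  qed (use act_part[OF _ _ that(1) w01(2)] act_part[OF _ _ that(1) w01(3)] w01
      in \<open>auto intro: cvec.subspace_scale[OF subspace_part]\<close>)
  have "act M e_gl w1 = 0 \<and> act M e_gl w0 = 0"
  proof (rule split)
    show "act M e_gl w1 + act M e_gl w0 = 0 + 0"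
      using w(3) act_add[OF w01_carrier, of e_gl] by (simp add: w01(1) add.commute)
  qed (use act_part[OF _ _ unit_degrees(1) w01(2)] act_part[OF _ _ unit_degrees(1) w01(3)]
      in \<open>auto simp: cvec.subspace_0 subspace_part\<close>)
  then have "typical_highest_weight M p (of_int m) (of_int n) u"
    if "(p, u) \<in> {(0, w0), (1, w1)}" "u \<noteq> 0" for p u
    using that w01 mn weight[OF unit_degrees(3) w(4)] weight[OF unit_degrees(4) w(5)]
    by unfold_locales (auto simp flip: of_int_add)
  then obtain p u where u: "typical_highest_weight M p (of_int m) (of_int n) u"
    using w(2) w01(1) by (cases "w0 = 0") auto
  then interpret typical_highest_weight M p "of_int m" "of_int n" u .
  have "u \<in> cvec.span {u, act M f_gl u}" by (simp add: cvec.span_base)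
  then have "carrier M = cvec.span {u, act M f_gl u}"
    using irr submodule_span nonzero unfolding irreducible_module_def by blast
  with u show ?thesis by (rule that)
qed

text \<open>A model of the two-dimensional module with \<open>v\<close> at index 0 and \<open>f v\<close> at index 1. It shows that the choice
  in the definition of \<open>L\<close> is made from a nonempty collection.\<close>

definition standard_L :: "complex \<Rightarrow> complex \<Rightarrow> (nat \<Rightarrow> complex) gl_module" where
  "standard_L m n =
     \<lparr> part = (\<lambda>\<gamma>. {g. \<forall>i. g i \<noteq> 0 \<longrightarrow> i = \<gamma>}),
       act = (\<lambda>a g i. if i = 0 then fst (typical_act m n a (g 0, g 1))
                      else if i = 1 then snd (typical_act m n a (g 0, g 1)) else 0) \<rparr>"

lemma is_module_standard_L: "is_module (standard_L m n)"
  unfolding is_module_def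
proof (intro conjI ballI allI)
  show "cvec.subspace (part (standard_L m n) 0)" "cvec.subspace (part (standard_L m n) 1)"
    by (simp_all add: standard_L_def cvec.subspace_def scaleC_fun_def scaleC_complex_def)
      (metis add.right_neutral)+
  show "part (standard_L m n) 0 \<inter> part (standard_L m n) 1 = {0}"
    by (auto simp: standard_L_def fun_eq_iff) (metis zero_neq_one One_nat_def)
next
  fix \<alpha> \<beta> :: nat and a v
  assume "\<alpha> \<in> {0,1}" "\<beta> \<in> {0,1}" "a \<in> gl_part \<alpha>" "v \<in> part (standard_L m n) \<beta>"
  then show "act (standard_L m n) a v \<in> part (standard_L m n) ((\<alpha> + \<beta>) mod 2)"
    by (auto simp: standard_L_def typical_act_def gl_part_0_iff gl_part_1_iff)
next
  fix \<alpha> \<beta> :: nat and a b v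
  assume "\<alpha> \<in> {0,1}" "\<beta> \<in> {0,1}" "a \<in> gl_part \<alpha>" "b \<in> gl_part \<beta>"
  then show "act (standard_L m n) (bracket \<alpha> \<beta> a b) v =
     act (standard_L m n) a (act (standard_L m n) b v) -
     (-1) ^ (\<alpha> * \<beta>) *\<^sub>C act (standard_L m n) b (act (standard_L m n) a v)"
    by (auto simp: standard_L_def typical_act_def gl_part_0_iff gl_part_1_iff fun_eq_iff
        scaleC_fun_def scaleC_complex_def bracket_def gl_mult_entry algebra_simps)
qed (auto simp: standard_L_def typical_act_def fun_eq_iff scaleC_fun_def scaleC_complex_def
    algebra_simps)

lemma is_L_standard_L:
  assumes "m + n \<noteq> 0"
  shows "is_L m n (standard_L (of_int m) (of_int n))"
proof -
  let ?M = "standard_L (of_int m) (of_int n)"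
  define v :: "nat \<Rightarrow> complex" where "v i = (if i = 0 then 1 else 0)" for i
  have "typical_highest_weight ?M 0 (of_int m) (of_int n) v"
  proof unfold_locales
    show "is_module ?M" by (rule is_module_standard_L)
    show "v \<noteq> 0" by (auto simp: v_def fun_eq_iff)
  qed (use assms in \<open>auto simp: v_def standard_L_def typical_act_def fun_eq_iff scaleC_fun_def
      scaleC_complex_def simp flip: of_int_add\<close>)
  then interpret typical_highest_weight ?M 0 "of_int m" "of_int n" v .
  have gen: "carrier ?M = cvec.span {v, act ?M f_gl v}"
  proof
    show "carrier ?M \<subseteq> cvec.span {v, act ?M f_gl v}"
    proof
      fix g assume "g \<in> carrier ?M"
      then obtain g0 g1 where g: "g = g0 + g1" "\<forall>i. g0 i \<noteq> 0 \<longrightarrow> i = 0" "\<forall>i. g1 i \<noteq> 0 \<longrightarrow> i = 1"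
        by (auto simp: carrier_def standard_L_def)
      have "g i = hw_comb ?M v (g 0, g 1) i" for i
      proof (cases "i = 0 \<or> i = 1")
        case True
        then show ?thesis
          by (auto simp: hw_comb_def v_def standard_L_def typical_act_def scaleC_fun_def
              scaleC_complex_def)
      next
        case False
        then have "g0 i = 0" "g1 i = 0" using g by blast+
        then show ?thesis
          using False by (simp add: g(1) hw_comb_def v_def standard_L_def scaleC_fun_def
              scaleC_complex_def)
      qed
      then have "g = hw_comb ?M v (g 0, g 1)" by (rule ext)
      then show "g \<in> cvec.span {v, act ?M f_gl v}" unfolding range_hw_comb[symmetric] by blast
    qed
    show "cvec.span {v, act ?M f_gl v} \<subseteq> carrier ?M"
      unfolding range_hw_comb[symmetric] using hw_comb_carrier by blast
  qed
  have "finite_dim ?M" unfolding finite_dim_def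
    by (rule exI, rule conjI[OF _ gen], simp)
  moreover have "highest_weight_vector ?M m n v"
    by (simp add: highest_weight_vector_def v_carrier nonzero e_v h1_v h2_v)
  ultimately show ?thesis using irreducible_if_generated[OF gen] by (auto simp: is_L_def)
qed

lemma is_L_L: "m + n \<noteq> 0 \<Longrightarrow> is_L m n (L m n)"
  unfolding L_def by (rule someI) (rule is_L_standard_L)

section \<open>Direct sums\<close>

lemma carrier_direct_sum:
  assumes "\<And>j. j \<in> J \<Longrightarrow> is_module (N j)"
  shows "carrier (direct_sum J N) =
    {f. finite {j. f j \<noteq> 0} \<and> (\<forall>j\<in>J. f j \<in> carrier (N j)) \<and> (\<forall>j. j \<notin> J \<longrightarrow> f j = 0)}"
    (is "_ = ?C")
proof
  show "carrier (direct_sum J N) \<subseteq> ?C"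
  proof
    fix f assume "f \<in> carrier (direct_sum J N)"
    then obtain g h where f: "f = g + h" and fin: "finite {j. g j \<noteq> 0}" "finite {j. h j \<noteq> 0}"
      and gh: "\<forall>j\<in>J. g j \<in> part (N j) 0" "\<forall>j\<in>J. h j \<in> part (N j) 1"
        "\<forall>j. j \<notin> J \<longrightarrow> g j = 0" "\<forall>j. j \<notin> J \<longrightarrow> h j = 0"
      by (auto simp: carrier_def direct_sum_def)
    have "finite {j. f j \<noteq> 0}"
      by (rule finite_subset[OF _ finite_UnI[OF fin]]) (auto simp: f)
    then show "f \<in> ?C" using gh by (auto simp: f carrier_def)
  qed
  show "?C \<subseteq> carrier (direct_sum J N)"
  proof
    fix f assume f: "f \<in> ?C"
    then have "\<forall>j\<in>J. \<exists>u. f j = fst u + snd u \<and> fst u \<in> part (N j) 0 \<and> snd u \<in> part (N j) 1"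
      by (auto simp: carrier_def)
    then obtain u where u: "\<forall>j\<in>J. f j = fst (u j) + snd (u j) \<and> fst (u j) \<in> part (N j) 0
        \<and> snd (u j) \<in> part (N j) 1"
      by metis
    \<comment> \<open>Both parts are set to zero wherever \<open>f\<close> vanishes, so that their supports stay finite.\<close>
    define g h where "g j = (if f j = 0 then 0 else fst (u j))"
      and "h j = (if f j = 0 then 0 else snd (u j))" for j
    have zero: "0 \<in> part (N j) 0" "0 \<in> part (N j) 1" if "j \<in> J" for j
      using assms[OF that] by (auto simp: is_module_def cvec.subspace_0)
    have "finite {j. g j \<noteq> 0}" "finite {j. h j \<noteq> 0}"
      using f by (auto simp: g_def h_def elim!: rev_finite_subset)
    then have "g \<in> part (direct_sum J N) 0" "h \<in> part (direct_sum J N) 1"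
      using f u zero by (auto simp: direct_sum_def g_def h_def)
    moreover have "f = g + h" using f u by (auto simp: fun_eq_iff g_def h_def)
    ultimately show "f \<in> carrier (direct_sum J N)" unfolding carrier_def by blast
  qed
qed

lemma is_module_direct_sum:
  assumes N: "\<And>j. j \<in> J \<Longrightarrow> is_module (N j)"
  shows "is_module (direct_sum J N)"
proof -
  have gl: "gl11_module (N j)" if "j \<in> J" for j using N[OF that] by unfold_locales
  have mem: "f j \<in> carrier (N j)" if "f \<in> carrier (direct_sum J N)" "j \<in> J" for f j
    using that by (simp add: carrier_direct_sum[OF N])
  have sub: "cvec.subspace (part (direct_sum J N) \<alpha>)" if \<alpha>: "\<alpha> \<in> {0,1}" for \<alpha>
  proof (rule cvec.subspaceI)
    note part = gl11_module.subspace_part[OF gl \<alpha>]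
    show "0 \<in> part (direct_sum J N) \<alpha>"
      using cvec.subspace_0[OF part] by (simp add: direct_sum_def)
    show "f + g \<in> part (direct_sum J N) \<alpha>"
      if "f \<in> part (direct_sum J N) \<alpha>" "g \<in> part (direct_sum J N) \<alpha>" for f g
    proof -
      have "finite ({j. f j \<noteq> 0} \<union> {j. g j \<noteq> 0})" using that by (simp add: direct_sum_def)
      then have "finite {j. (f + g) j \<noteq> 0}" by (rule rev_finite_subset) auto
      then show ?thesis using that cvec.subspace_add[OF part] by (simp add: direct_sum_def)
    qed
    show "c *\<^sub>C f \<in> part (direct_sum J N) \<alpha>" if "f \<in> part (direct_sum J N) \<alpha>" for c f
    proof -
      have "finite {j. f j \<noteq> 0}" using that by (simp add: direct_sum_def)
      then have "finite {j. (c *\<^sub>C f) j \<noteq> 0}" by (rule rev_finite_subset) (auto simp: scaleC_fun_def)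
      then show ?thesis
        using that cvec.subspace_scale[OF part] by (simp add: direct_sum_def scaleC_fun_def)
    qed
  qed
  show ?thesis
    unfolding is_module_def
  proof (intro conjI ballI allI)
    show "cvec.subspace (part (direct_sum J N) 0)" "cvec.subspace (part (direct_sum J N) 1)"
      by (simp_all add: sub)
    show "part (direct_sum J N) 0 \<inter> part (direct_sum J N) 1 = {0}"
    proof
      show "{0} \<subseteq> part (direct_sum J N) 0 \<inter> part (direct_sum J N) 1"
        using cvec.subspace_0[OF sub] by simp
      show "part (direct_sum J N) 0 \<inter> part (direct_sum J N) 1 \<subseteq> {0}"
      proof
        fix f assume f: "f \<in> part (direct_sum J N) 0 \<inter> part (direct_sum J N) 1"
        have "f j = 0" for j
        proof (cases "j \<in> J")
          case True
          then show ?thesis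
            using f gl11_module.part_Int[OF gl[OF True]] by (auto simp: direct_sum_def)
        qed (use f in \<open>simp add: direct_sum_def\<close>)
        then show "f \<in> {0}" by (simp add: fun_eq_iff)
      qed
    qed
  next
    fix \<alpha> \<beta> :: nat and a f
    assume ab: "\<alpha> \<in> {0,1}" "\<beta> \<in> {0,1}" "a \<in> gl_part \<alpha>" and f: "f \<in> part (direct_sum J N) \<beta>"
    have "finite {j. f j \<noteq> 0}" using f by (simp add: direct_sum_def)
    then have "finite {j. act (direct_sum J N) a f j \<noteq> 0}"
      by (rule rev_finite_subset)
        (use gl11_module.act_zero[OF gl] in \<open>auto simp: direct_sum_def split: if_splits\<close>)
    then show "act (direct_sum J N) a f \<in> part (direct_sum J N) ((\<alpha> + \<beta>) mod 2)"
      using f gl11_module.act_part[OF gl ab] by (simp add: direct_sum_def)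
  next
    fix \<alpha> \<beta> :: nat and a b f
    assume "\<alpha> \<in> {0,1}" "\<beta> \<in> {0,1}" "a \<in> gl_part \<alpha>" "b \<in> gl_part \<beta>"
      and f: "f \<in> carrier (direct_sum J N)"
    then show "act (direct_sum J N) (bracket \<alpha> \<beta> a b) f =
       act (direct_sum J N) a (act (direct_sum J N) b f) -
       (-1) ^ (\<alpha> * \<beta>) *\<^sub>C act (direct_sum J N) b (act (direct_sum J N) a f)"
      using gl11_module.act_bracket[OF gl _ _ _ _ mem[OF f]]
      by (simp add: direct_sum_def fun_eq_iff scaleC_fun_def)
  next
    fix a f g assume fg: "f \<in> carrier (direct_sum J N)" "g \<in> carrier (direct_sum J N)"
    then show "act (direct_sum J N) a (f + g) = act (direct_sum J N) a f + act (direct_sum J N) a g"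
      using gl11_module.act_add[OF gl mem[OF fg(1)] mem[OF fg(2)]]
      by (simp add: direct_sum_def fun_eq_iff)
  next
    fix a c f assume f: "f \<in> carrier (direct_sum J N)"
    show "act (direct_sum J N) a (c *\<^sub>C f) = c *\<^sub>C act (direct_sum J N) a f"
      using gl11_module.act_scale[OF gl mem[OF f]]
      by (simp add: direct_sum_def fun_eq_iff scaleC_fun_def)
    show "act (direct_sum J N) (c *\<^sub>C a) f = c *\<^sub>C act (direct_sum J N) a f"
      using gl11_module.act_scale_left[OF gl mem[OF f]]
      by (simp add: direct_sum_def fun_eq_iff scaleC_fun_def)
  next
    fix a b f assume f: "f \<in> carrier (direct_sum J N)"
    show "act (direct_sum J N) (a + b) f = act (direct_sum J N) a f + act (direct_sum J N) b f"
      using gl11_module.act_add_left[OF gl mem[OF f]]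
      by (simp add: direct_sum_def fun_eq_iff)
  qed
qed

text \<open>Isomorphisms from the outer summands onto the inner ones are added up to a map from the outer direct
  sum; bijectivity is the existence and uniqueness of the inner decomposition.\<close>

lemma internal_direct_sum_iso:
  assumes M: "is_module M" and sum: "internal_direct_sum M S W"
    and \<sigma>: "bij_betw \<sigma> J S"
    and N: "\<And>j. j \<in> J \<Longrightarrow> is_module (N j)"
    and \<phi>: "\<And>j. j \<in> J \<Longrightarrow> equivariant_iso (N j) (carrier (N j)) M (W (\<sigma> j)) (\<phi> j)"
  shows "M \<cong>\<^sub>g direct_sum J N"
proof (rule module_iso_sym)
  interpret gl11_module M by unfold_locales (rule M)
  have gl: "gl11_module (N j)" if "j \<in> J" for j using N[OF that] by unfold_locales
  have "finite S" using sum by (simp add: internal_direct_sum_def)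
  then have J: "finite J" using bij_betw_finite[OF \<sigma>] by simp
  have W: "W s \<subseteq> carrier M" if "s \<in> S" for s
  proof -
    have "W s = {u + v | u v. u \<in> W s \<inter> part M 0 \<and> v \<in> W s \<inter> part M 1}"
      using sum that by (simp add: internal_direct_sum_def submodule_def)
    then show ?thesis unfolding carrier_def by blast
  qed
  have unique: "\<exists>!w. w \<in> (\<Pi>\<^sub>E s\<in>S. W s) \<and> v = (\<Sum>s\<in>S. w s)" if "v \<in> carrier M" for v
    using sum that by (simp add: internal_direct_sum_def)
  let ?D = "direct_sum J N"
  have mem: "f j \<in> carrier (N j)" if "f \<in> carrier ?D" "j \<in> J" for f j
    using that by (simp add: carrier_direct_sum[OF N])
  have outside: "f j = 0" if "f \<in> carrier ?D" "j \<notin> J" for f j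
    using that by (simp add: carrier_direct_sum[OF N])
  have \<sigma>_S: "\<sigma> j \<in> S" if "j \<in> J" for j using \<sigma> that by (auto simp: bij_betw_def)
  define \<tau> where "\<tau> = inv_into J \<sigma>"
  have \<tau>: "\<tau> s \<in> J" "\<sigma> (\<tau> s) = s" if "s \<in> S" for s
    using that \<sigma> by (auto simp: \<tau>_def bij_betw_def inv_into_into f_inv_into_f)
  have \<tau>_\<sigma>: "\<tau> (\<sigma> j) = j" if "j \<in> J" for j
    using that \<sigma> by (auto simp: \<tau>_def bij_betw_def)
  note bij = equivariant_isoD(1)[OF \<phi>]
  have \<phi>_W: "\<phi> j (f j) \<in> W (\<sigma> j)" if "f \<in> carrier ?D" "j \<in> J" for f j
    using bij[OF that(2)] mem[OF that] by (auto simp: bij_betw_def)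
  have \<phi>_carrier: "\<phi> j (f j) \<in> carrier M" if "f \<in> carrier ?D" "j \<in> J" for f j
    using \<phi>_W[OF that] W[OF \<sigma>_S[OF that(2)]] by blast
  define \<psi> where "\<psi> f = (\<Sum>j\<in>J. \<phi> j (f j))" for f
  \<comment> \<open>The components of \<open>\<psi> f\<close>, reindexed by \<open>S\<close>, to be compared by uniqueness.\<close>
  define comp where "comp f = (\<lambda>s\<in>S. \<phi> (\<tau> s) (f (\<tau> s)))" for f
  have comp: "comp f \<in> (\<Pi>\<^sub>E s\<in>S. W s)" "\<psi> f = (\<Sum>s\<in>S. comp f s)" if f: "f \<in> carrier ?D" for f
  proof -
    show "comp f \<in> (\<Pi>\<^sub>E s\<in>S. W s)"
      unfolding comp_def using \<phi>_W[OF f \<tau>(1)] \<tau>(2) by (intro restrict_PiE_iff[THEN iffD2]) auto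
    show "\<psi> f = (\<Sum>s\<in>S. comp f s)"
      unfolding \<psi>_def sum.reindex_bij_betw[OF \<sigma>, symmetric]
      by (rule sum.cong) (auto simp: comp_def \<sigma>_S \<tau>_\<sigma>)
  qed
  have \<psi>_carrier: "\<psi> f \<in> carrier M" if "f \<in> carrier ?D" for f
    unfolding \<psi>_def by (rule cvec.subspace_sum[OF subspace_carrier]) (rule \<phi>_carrier[OF that])
  have "inj_on \<psi> (carrier ?D)"
  proof (rule inj_onI)
    fix f g assume f: "f \<in> carrier ?D" and g: "g \<in> carrier ?D" and eq: "\<psi> f = \<psi> g"
    have c: "comp f = comp g"
      using unique[OF \<psi>_carrier[OF f]] comp[OF f] comp[OF g] eq by metis
    have "f j = g j" for j
    proof (cases "j \<in> J")
      case True
      have "\<phi> j (f j) = \<phi> j (g j)"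
        using fun_cong[OF c, of "\<sigma> j"] True by (simp add: comp_def \<sigma>_S \<tau>_\<sigma>)
      then show ?thesis
        using bij[OF True] mem[OF f True] mem[OF g True] by (auto simp: bij_betw_def dest: inj_onD)
    qed (simp add: outside f g)
    then show "f = g" by blast
  qed
  moreover have "carrier M \<subseteq> \<psi> ` carrier ?D"
  proof
    fix v assume "v \<in> carrier M"
    then obtain w where w: "w \<in> (\<Pi>\<^sub>E s\<in>S. W s)" and v: "v = (\<Sum>s\<in>S. w s)"
      using unique by blast
    define f where "f j = (if j \<in> J then inv_into (carrier (N j)) (\<phi> j) (w (\<sigma> j)) else 0)" for j
    have f: "f j \<in> carrier (N j)" "\<phi> j (f j) = w (\<sigma> j)" if "j \<in> J" for j
    proof -
      have "w (\<sigma> j) \<in> \<phi> j ` carrier (N j)"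
        using w \<sigma>_S[OF that] bij[OF that] by (auto simp: bij_betw_def)
      then show "f j \<in> carrier (N j)" "\<phi> j (f j) = w (\<sigma> j)"
        using that by (simp_all add: f_def inv_into_into f_inv_into_f)
    qed
    have "finite {j. f j \<noteq> 0}"
      by (rule finite_subset[OF _ J]) (auto simp: f_def)
    then have "f \<in> carrier ?D" using f by (simp add: carrier_direct_sum[OF N]) (simp add: f_def)
    moreover have "\<psi> f = v"
      unfolding \<psi>_def v sum.reindex_bij_betw[OF \<sigma>, symmetric] by (rule sum.cong) (auto simp: f)
    ultimately show "v \<in> \<psi> ` carrier ?D" by blast
  qed
  ultimately have "bij_betw \<psi> (carrier ?D) (carrier M)"
    using \<psi>_carrier by (auto simp: bij_betw_def)
  then have "equivariant_iso ?D (carrier ?D) M (carrier M) \<psi>"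
  proof (rule equivariant_isoI)
    fix f assume f: "f \<in> carrier ?D"
    show "\<psi> (f + g) = \<psi> f + \<psi> g" if g: "g \<in> carrier ?D" for g
      unfolding \<psi>_def sum.distrib[symmetric]
      by (rule sum.cong) (simp_all add: equivariant_isoD(2)[OF \<phi>] mem f g)
    show "\<psi> (c *\<^sub>C f) = c *\<^sub>C \<psi> f" for c
      unfolding \<psi>_def cvec.scale_sum_right
      by (rule sum.cong) (simp_all add: scaleC_fun_def equivariant_isoD(3)[OF \<phi>] mem f)
    show "\<psi> (act ?D a f) = act M a (\<psi> f)" for a
    proof -
      have "act M a (\<psi> f) = (\<Sum>j\<in>J. act M a (\<phi> j (f j)))"
        unfolding \<psi>_def by (rule act_sum) (rule \<phi>_carrier[OF f])
      also have "\<dots> = \<psi> (act ?D a f)"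
        unfolding \<psi>_def
        by (rule sum.cong) (simp_all add: direct_sum_def equivariant_isoD(4)[OF \<phi>] mem[OF f])
      finally show ?thesis by simp
    qed
  qed
  then show "?D \<cong>\<^sub>g M" using M is_module_direct_sum[OF N] by (auto simp: module_iso_iff)
qed


section \<open>Tensor powers are modules\<close>

lemma parity_simps [simp]: "parity 1 = 0" "parity 2 = 1"
  by (simp_all add: parity_def)

lemma tensor_act_add:
  "tensor_act k a (\<lambda>js. t js + t' js) js = tensor_act k a t js + tensor_act k a t' js"
proof (induction k arbitrary: a t t' js)
  case (Suc k)
  then show ?case
    by (cases js) (simp_all add: tensor_act_Suc_apply sum_2 algebra_simps del: tensor_act.simps)
qed simp

lemma tensor_act_add_left: "tensor_act k (a + b) t js = tensor_act k a t js + tensor_act k b t js"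
proof (induction k arbitrary: a b t js)
  case (Suc k)
  have "gl_proj \<alpha> (a + b) = gl_proj \<alpha> a + gl_proj \<alpha> b" for \<alpha>
    by (simp add: gl_proj_def vec_eq_iff)
  with Suc show ?case
    by (cases js) (simp_all add: tensor_act_Suc_apply sum_2 algebra_simps del: tensor_act.simps)
qed simp

lemma tensor_act_scale_left: "tensor_act k (c *\<^sub>C a) t js = c * tensor_act k a t js"
proof (induction k arbitrary: a t js)
  case (Suc k)
  have "gl_proj \<alpha> (c *\<^sub>C a) = c *\<^sub>C gl_proj \<alpha> a" for \<alpha>
    by (simp add: gl_proj_def vec_eq_iff scaleC_vec_def scaleC_complex_def)
  with Suc show ?case
    by (cases js) (simp_all add: tensor_act_Suc_apply sum_2 algebra_simps del: tensor_act.simps)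
qed simp

text \<open>For homogeneous \<open>a\<close> only one of the two projections in the recursion survives.\<close>

lemma tensor_act_homogeneous:
  assumes "\<alpha> \<in> {0,1}" "a \<in> gl_part \<alpha>"
  shows "tensor_act (Suc k) a t (i # js) =
    (a$i$1 * t (1 # js) + a$i$2 * t (2 # js)) +
    (-1) ^ (\<alpha> * parity i) * tensor_act k a (\<lambda>js. t (i # js)) js"
proof -
  have "gl_proj \<gamma> a = (if \<gamma> = \<alpha> then a else 0)" if "\<gamma> \<in> {0,1}" for \<gamma>
    using assms that by (auto simp: gl_proj_def gl_part_def vec_eq_iff split: if_splits)
  then show ?thesis
    using assms(1) by (auto simp: tensor_act_Suc_apply sum_2 tensor_act_zero simp del: tensor_act.simps)
qed

lemma bracket_degree:
  "\<lbrakk>\<alpha> \<in> {0,1}; \<beta> \<in> {0,1}; a \<in> gl_part \<alpha>; b \<in> gl_part \<beta>\<rbrakk>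
    \<Longrightarrow> bracket \<alpha> \<beta> a b \<in> gl_part ((\<alpha> + \<beta>) mod 2)"
  by (auto simp: gl_part_0_iff gl_part_1_iff bracket_def gl_mult_entry)

text \<open>In the composition of two actions, the mixed terms (one matrix on the first factor, the other on the
  remaining ones) cancel: a nonzero entry \<open>a\<^sub>i\<^sub>l\<close> forces the parities of \<open>i\<close> and \<open>l\<close> to differ by the degree of
  \<open>a\<close>, and this makes the signs agree. The induction hypothesis deals with the remaining factors.\<close>

lemma tensor_act_bracket:
  assumes "\<alpha> \<in> {0,1}" "\<beta> \<in> {0,1}" "a \<in> gl_part \<alpha>" "b \<in> gl_part \<beta>"
  shows "tensor_act k (bracket \<alpha> \<beta> a b) t js =
    tensor_act k a (tensor_act k b t) js - (-1) ^ (\<alpha> * \<beta>) * tensor_act k b (tensor_act k a t) js"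
proof (induction k arbitrary: t js)
  case (Suc k)
  have deg: "(\<alpha> + \<beta>) mod 2 \<in> {0,1}" by auto
  show ?case
  proof (cases js)
    case (Cons i js')
    note hom = tensor_act_homogeneous[OF assms(1,3)] tensor_act_homogeneous[OF assms(2,4)]
      tensor_act_homogeneous[OF deg bracket_degree[OF assms]]
    show ?thesis
      using exhaust_2[of i] assms unfolding Cons hom tensor_act_add tensor_act_scale Suc.IH
      by (auto simp: gl_part_0_iff gl_part_1_iff bracket_def gl_mult_entry algebra_simps)
  qed (simp add: tensor_act_Suc_apply del: tensor_act.simps)
qed simp

text \<open>A nonzero coordinate of \<open>a t\<close> comes from a nonzero coordinate of \<open>t\<close> at an index list of the same length
  and with parity shifted by the degree of \<open>a\<close>. This is what compatibility with the grading amounts to.\<close>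

lemma tensor_act_support:
  assumes a: "\<alpha> \<in> {0,1}" "a \<in> gl_part \<alpha>"
  shows "tensor_act k a t is \<noteq> 0 \<Longrightarrow>
    \<exists>is'. t is' \<noteq> 0 \<and> length is' = length is \<and>
      (\<Sum>i\<leftarrow>is. parity i) mod 2 = ((\<Sum>i\<leftarrow>is'. parity i) + \<alpha>) mod 2"
proof (induction k arbitrary: t "is")
  case (Suc k)
  obtain i js where "is": "is = i # js"
    using Suc.prems by (cases "is") (auto simp: tensor_act_Suc_apply simp del: tensor_act.simps)
  have "a$i$1 * t (1 # js) \<noteq> 0 \<or> a$i$2 * t (2 # js) \<noteq> 0 \<or> tensor_act k a (\<lambda>js. t (i # js)) js \<noteq> 0"
    using Suc.prems unfolding "is" tensor_act_homogeneous[OF a] by force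
  then consider l where "a$i$l \<noteq> 0" "t (l # js) \<noteq> 0" | "tensor_act k a (\<lambda>js. t (i # js)) js \<noteq> 0"
    by (metis mult_not_zero)
  then show ?case
  proof cases
    case 1
    have "parity i mod 2 = (parity l + \<alpha>) mod 2"
      using 1(1) a exhaust_2[of i] exhaust_2[of l] by (auto simp: gl_part_0_iff gl_part_1_iff)
    then have "(\<Sum>i\<leftarrow>i # js. parity i) mod 2 = ((\<Sum>i\<leftarrow>l # js. parity i) + \<alpha>) mod 2"
      by simp presburger
    then show ?thesis using 1(2) "is" by (intro exI[of _ "l # js"]) simp
  next
    case 2
    from Suc.IH[OF this] obtain js' where js': "t (i # js') \<noteq> 0" "length js' = length js"
      "(\<Sum>i\<leftarrow>js. parity i) mod 2 = ((\<Sum>i\<leftarrow>js'. parity i) + \<alpha>) mod 2"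
      by blast
    have "(\<Sum>i\<leftarrow>i # js. parity i) mod 2 = ((\<Sum>i\<leftarrow>i # js'. parity i) + \<alpha>) mod 2"
      using mod_add_cong[OF refl js'(3), of "parity i"] by (simp add: add.assoc)
    then show ?thesis using js'(1,2) "is" by (intro exI[of _ "i # js'"]) simp
  qed
qed simp

lemma carrier_tensor_power: "carrier (tensor_power k) = {t. \<forall>is. t is \<noteq> 0 \<longrightarrow> length is = k}"
proof
  show "carrier (tensor_power k) \<subseteq> {t. \<forall>is. t is \<noteq> 0 \<longrightarrow> length is = k}"
    unfolding carrier_def tensor_power_def by (auto, metis add_0)
  show "{t. \<forall>is. t is \<noteq> 0 \<longrightarrow> length is = k} \<subseteq> carrier (tensor_power k)"
  proof
    fix t :: tensor assume "t \<in> {t. \<forall>is. t is \<noteq> 0 \<longrightarrow> length is = k}"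
    then have t: "t is \<noteq> 0 \<Longrightarrow> length is = k" for "is" by blast
    define t' where "t' \<alpha> is = (if (\<Sum>i\<leftarrow>is. parity i) mod 2 = \<alpha> then t is else 0)" for \<alpha> "is"
    have "t' \<alpha> \<in> part (tensor_power k) \<alpha>" for \<alpha>
      using t by (simp add: t'_def tensor_power_def)
    moreover have "t = t' 0 + t' 1"
    proof
      fix "is"
      consider "(\<Sum>i\<leftarrow>is. parity i) mod 2 = 0" | "(\<Sum>i\<leftarrow>is. parity i) mod 2 = 1"
        by linarith
      then show "t is = (t' 0 + t' 1) is" by cases (simp_all only: t'_def plus_fun_apply, simp_all)
    qed
    ultimately show "t \<in> carrier (tensor_power k)" unfolding carrier_def by blast
  qed
qed

lemma is_module_tensor_power: "is_module (tensor_power k)"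
  unfolding is_module_def
proof (intro conjI ballI allI)
  have "cvec.subspace (part (tensor_power k) \<alpha>)" for \<alpha>
    by (rule cvec.subspaceI)
      (auto simp: tensor_power_def scaleC_fun_def scaleC_complex_def, (metis add_0)+)
  then show "cvec.subspace (part (tensor_power k) 0)" "cvec.subspace (part (tensor_power k) 1)"
    by simp_all
  show "part (tensor_power k) 0 \<inter> part (tensor_power k) 1 = {0}"
    by (auto simp: tensor_power_def fun_eq_iff)
next
  fix \<alpha> \<beta> :: nat and a t
  assume ab: "\<alpha> \<in> {0,1}" "\<beta> \<in> {0,1}" "a \<in> gl_part \<alpha>" and t: "t \<in> part (tensor_power k) \<beta>"
  have "length is = k \<and> (\<Sum>i\<leftarrow>is. parity i) mod 2 = (\<alpha> + \<beta>) mod 2"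
    if nz: "tensor_act k a t is \<noteq> 0" for "is"
  proof -
    obtain is' where "t is' \<noteq> 0" "length is' = length is"
      "(\<Sum>i\<leftarrow>is. parity i) mod 2 = ((\<Sum>i\<leftarrow>is'. parity i) + \<alpha>) mod 2"
      using tensor_act_support[OF ab(1,3) nz] by blast
    moreover from this have "length is' = k" "(\<Sum>i\<leftarrow>is'. parity i) mod 2 = \<beta>"
      using t by (auto simp: tensor_power_def)
    ultimately show ?thesis by (metis add.commute mod_add_left_eq)
  qed
  then show "act (tensor_power k) a t \<in> part (tensor_power k) ((\<alpha> + \<beta>) mod 2)"
    by (simp add: tensor_power_def)
next
  fix \<alpha> \<beta> :: nat and a b t
  assume "\<alpha> \<in> {0,1}" "\<beta> \<in> {0,1}" "a \<in> gl_part \<alpha>" "b \<in> gl_part \<beta>"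
  then show "act (tensor_power k) (bracket \<alpha> \<beta> a b) t =
     act (tensor_power k) a (act (tensor_power k) b t) -
     (-1) ^ (\<alpha> * \<beta>) *\<^sub>C act (tensor_power k) b (act (tensor_power k) a t)"
    by (intro ext) (simp add: tensor_power_def tensor_act_bracket scaleC_fun_def scaleC_complex_def)
qed (auto simp: tensor_power_def fun_eq_iff plus_fun_def tensor_act_add tensor_act_add_left
    tensor_act_scale tensor_act_scale_left scaleC_fun_def scaleC_complex_def)

interpretation tensor: gl11_module "tensor_power k" for k
  by unfold_locales (rule is_module_tensor_power)

lemma act_tensor_power [simp]: "act (tensor_power k) = tensor_act k"
  by (simp add: tensor_power_def)

text \<open>The matrices \<open>h\<^sub>1\<close> and \<open>h\<^sub>2\<close> act diagonally: their eigenvalues on a basis tensor are the numbers of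
  factors \<open>x\<close> and of factors \<open>y\<close>.\<close>

lemma tensor_act_h:
  assumes "length is = k"
  shows "tensor_act k h1_gl t is = of_nat (count_list is 1) * t is"
    and "tensor_act k h2_gl t is = of_nat (count_list is 2) * t is"
proof -
  note hom = tensor_act_homogeneous[OF _ unit_degrees(3)] tensor_act_homogeneous[OF _ unit_degrees(4)]
  have "tensor_act k h1_gl t is = of_nat (count_list is 1) * t is \<and>
      tensor_act k h2_gl t is = of_nat (count_list is 2) * t is"
    using assms
  proof (induction k arbitrary: t "is")
    case (Suc k)
    then obtain i js where "is": "is = i # js" "length js = k" by (cases "is") auto
    show ?case
      using exhaust_2[of i] Suc.IH[OF "is"(2)] unfolding "is"(1)
      by (auto simp: hom algebra_simps simp del: tensor_act.simps)
  qed simp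
  then show "tensor_act k h1_gl t is = of_nat (count_list is 1) * t is"
    and "tensor_act k h2_gl t is = of_nat (count_list is 2) * t is" by simp_all
qed

lemma count_list_1_2: "count_list is 1 + count_list is 2 = length (is :: 2 list)"
proof (induction "is")
  case (Cons i js)
  then show ?case using exhaust_2[of i] by auto
qed simp

text \<open>Both sides equal the action of \<open>h\<^sub>1 + h\<^sub>2\<close>, since every index list has \<open>k\<close> entries, each 1 or 2.\<close>

lemma tensor_power_e_f:
  assumes "t \<in> carrier (tensor_power k)"
  shows "tensor_act k e_gl (tensor_act k f_gl t) + tensor_act k f_gl (tensor_act k e_gl t)
    = of_nat k *\<^sub>C t"
proof -
  have "tensor_act k h1_gl t + tensor_act k h2_gl t = of_nat k *\<^sub>C t"
  proof
    fix "is"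
    have carrier: "tensor_act k h1_gl t \<in> carrier (tensor_power k)"
      "tensor_act k h2_gl t \<in> carrier (tensor_power k)"
      using tensor.act_carrier[OF assms] by simp_all
    show "(tensor_act k h1_gl t + tensor_act k h2_gl t) is = (of_nat k *\<^sub>C t) is"
    proof (cases "length is = k")
      case True
      then show ?thesis
        using count_list_1_2[of "is"]
        by (simp add: tensor_act_h scaleC_fun_def scaleC_complex_def flip: distrib_right of_nat_add)
    next
      case False
      then have "t is = 0" "tensor_act k h1_gl t is = 0" "tensor_act k h2_gl t is = 0"
        using assms carrier unfolding carrier_tensor_power by blast+
      then show ?thesis by (simp add: scaleC_fun_def)
    qed
  qed
  then show ?thesis using tensor.e_f[OF assms] by simp
qed

section \<open>The vectors v_s\<close>

definition basis_tensor :: "2 list \<Rightarrow> tensor" where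
  "basis_tensor is = (\<lambda>js. if js = is then 1 else 0)"

lemma pure_tensor_axis: "pure_tensor (map (\<lambda>i. axis i 1) is) = basis_tensor is"
proof (induction "is")
  case (Cons i "is")
  show ?case
  proof
    fix js show "pure_tensor (map (\<lambda>i. axis i 1) (i # is)) js = basis_tensor (i # is) js"
      by (cases js) (simp_all add: Cons.IH, auto simp: basis_tensor_def axis_def)
  qed
qed (simp add: fun_eq_iff basis_tensor_def tensor_one_def)

text \<open>The index list of the basis tensor \<open>u\<^sub>s\<close>. Index 1 stands for \<open>x\<close> and index 2 for \<open>y\<close>.\<close>

definition subset_word :: "nat \<Rightarrow> nat set \<Rightarrow> 2 list" where
  "subset_word k s = map (\<lambda>i. if i \<in> s then 1 else 2) [1..<k]"

lemma length_subset_word [simp]: "length (subset_word k s) = k - 1"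
  by (simp add: subset_word_def)

lemma nth_subset_word:
  assumes "i \<in> {1..k-1}"
  shows "subset_word k s ! (i - 1) = (if i \<in> s then 1 else 2)"
proof -
  have "i - 1 < length [1..<k]" "[1..<k] ! (i - 1) = i" using assms by auto
  then show ?thesis by (simp add: subset_word_def del: length_upt)
qed

lemma bij_betw_subset_word: "bij_betw (subset_word k) (Pow {1..k-1}) {is. length is = k - 1}"
proof (rule bij_betwI[where g = "\<lambda>is. {i \<in> {1..k-1}. is ! (i - 1) = 1}"])
  show "{i \<in> {1..k-1}. subset_word k s ! (i - 1) = 1} = s" if "s \<in> Pow {1..k-1}" for s
    using that by (auto simp: nth_subset_word[simplified] split: if_splits)
  show "subset_word k {i \<in> {1..k-1}. is ! (i - 1) = 1} = is" if "is \<in> {is. length is = k - 1}"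
    for "is"
  proof (rule nth_equalityI)
    fix j assume "j < length (subset_word k {i \<in> {1..k-1}. is ! (i - 1) = 1})"
    then show "subset_word k {i \<in> {1..k-1}. is ! (i - 1) = 1} ! j = is ! j"
      using exhaust_2[of "is ! j"] by (auto simp: subset_word_def)
  qed (use that in simp)
qed auto

lemma count_subset_word:
  assumes "s \<subseteq> {1..k-1}"
  shows "count_list (subset_word k s) 1 = card s"
proof -
  have "count_list (subset_word k s) 1 = length (filter (\<lambda>i. i \<in> s) [1..<k])"
    unfolding subset_word_def by (induction k) auto
  also have "\<dots> = card (set (filter (\<lambda>i. i \<in> s) [1..<k]))"
    by (rule distinct_card[symmetric]) simp
  also have "set (filter (\<lambda>i. i \<in> s) [1..<k]) = s" using assms by fastforce
  finally show ?thesis .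
qed

lemma v_sub_eq: "v_sub k s = tensor_act k e_gl (basis_tensor (2 # subset_word k s))"
proof -
  have xy: "x_vec = axis 1 1" "y_vec = axis 2 1"
    by (simp_all add: x_vec_def y_vec_def vec_eq_iff forall_2 axis_def)
  have "u_list k s = map (\<lambda>i. axis i 1) (subset_word k s)"
    by (simp add: u_list_def subset_word_def xy)
  then have "y_vec \<otimes>\<^sub>t pure_tensor (u_list k s)
      = pure_tensor (map (\<lambda>i. axis i 1) (2 # subset_word k s))"
    by (simp add: xy)
  then show ?thesis unfolding v_sub_def by (simp only: pure_tensor_axis act_tensor_power)
qed

lemma basis_tensor_carrier: "basis_tensor is \<in> carrier (tensor_power (length is))"
  by (simp add: carrier_tensor_power basis_tensor_def)

lemma sum_tensor_apply: "(\<Sum>s\<in>S. (g s :: tensor)) is = (\<Sum>s\<in>S. g s is)"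
  by (induction S rule: infinite_finite_induct) simp_all

context
  fixes k :: nat
  assumes k: "k \<ge> 1"
begin

lemma basis_tensor_word_carrier: "basis_tensor (2 # subset_word k s) \<in> carrier (tensor_power k)"
  using basis_tensor_carrier[of "2 # subset_word k s"] k by simp

lemma tensor_act_e_Cons:
  "tensor_act k e_gl t (1 # js) = t (2 # js) + tensor_act (k - 1) e_gl (\<lambda>js. t (1 # js)) js"
  "tensor_act k e_gl t (2 # js) = - tensor_act (k - 1) e_gl (\<lambda>js. t (2 # js)) js"
  using tensor_act_homogeneous[OF _ unit_degrees(1), of "k - 1"] k by simp_all

text \<open>In \<open>v\<^sub>s = x \<otimes> u\<^sub>s - y \<otimes> e u\<^sub>s\<close> the part with first factor \<open>x\<close> is \<open>u\<^sub>s\<close>.\<close>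

lemma v_sub_leading: "v_sub k s (1 # js) = (if js = subset_word k s then 1 else 0)"
  by (simp add: v_sub_eq tensor_act_e_Cons basis_tensor_def tensor_act_zero_right)

text \<open>For \<open>t = x \<otimes> t\<^sub>x + y \<otimes> t\<^sub>y\<close> one has \<open>e t = x \<otimes> (t\<^sub>y + e t\<^sub>x) - y \<otimes> e t\<^sub>y\<close>. If the first term vanishes, then
  \<open>t\<^sub>y = - e t\<^sub>x\<close>, and \<open>e t\<^sub>y = - e (e t\<^sub>x) = 0\<close>. Applied to differences, this says that an element of the
  image of \<open>e\<close> is determined by its part with first factor \<open>x\<close>.\<close>

lemma image_e_determined:
  assumes lead: "\<And>js. tensor_act k e_gl t (1 # js) = 0"
  shows "tensor_act k e_gl t = 0"
proof
  fix "is"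
  have e_e: "tensor_act r e_gl (tensor_act r e_gl u) js = 0" for r u js
    using tensor_act_bracket[OF _ _ unit_degrees(1) unit_degrees(1), of r u js] unit_brackets(1)
    by (simp add: tensor_act_zero)
  have "t (2 # js) = (-1) * tensor_act (k - 1) e_gl (\<lambda>js. t (1 # js)) js" for js
    using lead[of js] by (simp add: tensor_act_e_Cons add_eq_0_iff2)
  then have "tensor_act k e_gl t (2 # js) = 0" for js
    by (simp only: tensor_act_e_Cons tensor_act_scale e_e) simp
  moreover have "tensor_act k e_gl t [] = 0"
    using tensor_act_Suc_apply(1)[of "k - 1"] k by simp
  ultimately show "tensor_act k e_gl t is = 0 is"
    using lead by (cases "is") (use exhaust_2 in \<open>auto simp del: One_nat_def, metis\<close>)
qed

lemma leading_coefficient: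
  assumes "s \<in> Pow {1..k-1}"
  shows "(\<Sum>s\<in>Pow {1..k-1}. c s *\<^sub>C v_sub k s) (1 # subset_word k s) = c s"
proof -
  have "(\<Sum>s\<in>Pow {1..k-1}. c s *\<^sub>C v_sub k s) (1 # subset_word k s)
      = (\<Sum>s'\<in>Pow {1..k-1}. if s' = s then c s' else 0)"
    unfolding sum_tensor_apply
    using assms bij_betw_imp_inj_on[OF bij_betw_subset_word[of k]]
    by (intro sum.cong) (auto simp: scaleC_fun_def scaleC_complex_def v_sub_leading dest: inj_onD)
  then show ?thesis using assms by simp
qed

text \<open>Both sides lie in the image of \<open>e\<close>, the right-hand side because \<open>v\<^sub>s = e (y \<otimes> u\<^sub>s)\<close>, and their coordinates at
  \<open>x \<otimes> u\<^sub>s\<close> agree for every \<open>s\<close>.\<close>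

lemma image_e_expansion:
  assumes t: "t \<in> carrier (tensor_power k)"
  shows "tensor_act k e_gl t =
    (\<Sum>s\<in>Pow {1..k-1}. tensor_act k e_gl t (1 # subset_word k s) *\<^sub>C v_sub k s)"
proof -
  define c where "c s = tensor_act k e_gl t (1 # subset_word k s)" for s
  define b where "b = (\<Sum>s\<in>Pow {1..k-1}. c s *\<^sub>C basis_tensor (2 # subset_word k s))"
  let ?z = "\<Sum>s\<in>Pow {1..k-1}. c s *\<^sub>C v_sub k s"
  have summand: "c s *\<^sub>C basis_tensor (2 # subset_word k s) \<in> carrier (tensor_power k)" for s
    by (intro cvec.subspace_scale[OF tensor.subspace_carrier] basis_tensor_word_carrier)
  have b: "b \<in> carrier (tensor_power k)"
    unfolding b_def by (intro cvec.subspace_sum[OF tensor.subspace_carrier] summand)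
  have e_b: "tensor_act k e_gl b = ?z"
    using tensor.act_sum[OF summand] tensor.act_scale[OF basis_tensor_word_carrier]
    by (simp add: b_def v_sub_eq)
  have "t = (t - b) + b" by simp
  then have e_diff: "tensor_act k e_gl t = tensor_act k e_gl (t - b) + ?z"
    using tensor.act_add[OF cvec.subspace_diff[OF tensor.subspace_carrier t b] b] e_b by simp
  have "tensor_act k e_gl (t - b) (1 # js) = 0" for js
  proof (cases "length js = k - 1")
    case True
    then obtain s where "s \<in> Pow {1..k-1}" "js = subset_word k s"
      using bij_betw_imp_surj_on[OF bij_betw_subset_word[of k]] by blast
    then show ?thesis
      using fun_cong[OF e_diff, of "1 # js"] leading_coefficient[of s c] by (simp add: c_def)
  next
    case False
    have "tensor_act k e_gl (t - b) \<in> carrier (tensor_power k)"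
      using tensor.act_carrier[OF cvec.subspace_diff[OF tensor.subspace_carrier t b]] by simp
    then show ?thesis using False k by (fastforce simp: carrier_tensor_power)
  qed
  then have "tensor_act k e_gl (t - b) = 0" by (rule image_e_determined)
  then show ?thesis using e_diff by (simp add: c_def)
qed

text \<open>The basis tensor \<open>y \<otimes> u\<^sub>s\<close> has weight \<open>[|s|, k - |s|]\<close>, and \<open>e\<close> shifts weights by \<open>[1,-1]\<close>.\<close>

lemma v_sub_typical:
  assumes s: "s \<subseteq> {1..k-1}"
  obtains p where "typical_highest_weight (tensor_power k) p
    (of_int (int (card s) + 1)) (of_int (int k - 1 - int (card s))) (v_sub k s)"
proof
  let ?b = "basis_tensor (2 # subset_word k s)"
  let ?q = "(\<Sum>i\<leftarrow>2 # subset_word k s. parity i) mod 2"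
  note b = basis_tensor_word_carrier[of s]
  have q: "?q \<in> {0,1}" by auto
  have b_part: "?b \<in> part (tensor_power k) ?q"
    using k by (auto simp: tensor_power_def basis_tensor_def)
  have homogeneous: "v_sub k s \<in> part (tensor_power k) ((1 + ?q) mod 2)"
    unfolding v_sub_eq
    by (rule tensor.act_part[OF _ q unit_degrees(1) b_part, unfolded act_tensor_power]) simp
  have counts: "count_list (2 # subset_word k s) 1 = card s"
    "count_list (2 # subset_word k s) 2 = k - card s"
    using count_subset_word[OF s] count_list_1_2[of "2 # subset_word k s"] k by auto
  have card: "card s \<le> k"
    using card_mono[OF _ s] by simp
  have h: "tensor_act k h1_gl ?b = of_nat (card s) *\<^sub>C ?b"
    "tensor_act k h2_gl ?b = of_nat (k - card s) *\<^sub>C ?b"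
  proof -
    have len: "length (2 # subset_word k s) = k" using k by simp
    have h_carrier: "tensor_act k h ?b \<in> carrier (tensor_power k)" for h
      using tensor.act_carrier[OF b] by simp
    have "tensor_act k h1_gl ?b is = (of_nat (card s) *\<^sub>C ?b) is \<and>
        tensor_act k h2_gl ?b is = (of_nat (k - card s) *\<^sub>C ?b) is" for "is"
    proof (cases "length is = k")
      case True
      then show ?thesis
        using counts by (auto simp: tensor_act_h scaleC_fun_def scaleC_complex_def basis_tensor_def)
    next
      case False
      then have "tensor_act k h ?b is = 0" for h
        using h_carrier[of h] by (auto simp: carrier_tensor_power)
      moreover have "?b is = 0" using False len by (auto simp: basis_tensor_def)
      ultimately show ?thesis by (simp add: scaleC_fun_def scaleC_complex_def)
    qed
    then show "tensor_act k h1_gl ?b = of_nat (card s) *\<^sub>C ?b"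
      "tensor_act k h2_gl ?b = of_nat (k - card s) *\<^sub>C ?b" by (auto intro: ext)
  qed
  show "typical_highest_weight (tensor_power k) ((1 + ?q) mod 2)
    (of_int (int (card s) + 1)) (of_int (int k - 1 - int (card s))) (v_sub k s)"
  proof unfold_locales
    have n: "of_int (int k - 1 - int (card s)) = (of_nat (k - card s) - 1 :: complex)"
      using card by (simp add: of_nat_diff)
    show "v_sub k s \<noteq> 0"
      using v_sub_leading[of s "subset_word k s"] by auto
    show "act (tensor_power k) e_gl (v_sub k s) = 0"
      using tensor.e_e[OF b] by (simp add: v_sub_eq)
    show "act (tensor_power k) h1_gl (v_sub k s) = of_int (int (card s) + 1) *\<^sub>C v_sub k s"
      using tensor.h_commutation(1)[OF b] tensor.act_scale[OF b, of e_gl]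
      by (simp add: v_sub_eq h scaleC_add_left scaleC_one)
    show "act (tensor_power k) h2_gl (v_sub k s) = of_int (int k - 1 - int (card s)) *\<^sub>C v_sub k s"
      using tensor.h_commutation(2)[OF b] tensor.act_scale[OF b, of e_gl] unfolding n
      by (simp add: v_sub_eq h cvec.scale_left_diff_distrib scaleC_one)
    show "of_int (int (card s) + 1) + of_int (int k - 1 - int (card s)) \<noteq> (0::complex)"
      using k by simp
  qed (use homogeneous in auto)
qed

lemma V_sub_eq_range: "V_sub k s = range (hw_comb (tensor_power k) (v_sub k s))"
  unfolding V_sub_def by (rule range_hw_comb[symmetric])

text \<open>The operators \<open>e\<close> and \<open>e f\<close> separate the two coefficients of an element of \<open>V\<^sub>s\<close>; the factor \<open>k\<close> is the sum
  of the two weights of \<open>v\<^sub>s\<close>.\<close>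

lemma act_V_sub:
  assumes "s \<subseteq> {1..k-1}"
  shows "hw_comb (tensor_power k) (v_sub k s) z \<in> carrier (tensor_power k)"
    and "tensor_act k e_gl (hw_comb (tensor_power k) (v_sub k s) z) = (of_nat k * snd z) *\<^sub>C v_sub k s"
    and "tensor_act k e_gl (tensor_act k f_gl (hw_comb (tensor_power k) (v_sub k s) z))
      = (of_nat k * fst z) *\<^sub>C v_sub k s"
proof -
  obtain p where "typical_highest_weight (tensor_power k) p
      (of_int (int (card s) + 1)) (of_int (int k - 1 - int (card s))) (v_sub k s)"
    using v_sub_typical[OF assms] .
  then interpret v: typical_highest_weight "tensor_power k" p
    "of_int (int (card s) + 1)" "of_int (int k - 1 - int (card s))" "v_sub k s" .
  show "hw_comb (tensor_power k) (v_sub k s) z \<in> carrier (tensor_power k)"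
    by (rule v.hw_comb_carrier)
  show "tensor_act k e_gl (hw_comb (tensor_power k) (v_sub k s) z) = (of_nat k * snd z) *\<^sub>C v_sub k s"
    using v.act_hw_comb[of e_gl z] by (simp add: typical_act_def hw_comb_def)
  show "tensor_act k e_gl (tensor_act k f_gl (hw_comb (tensor_power k) (v_sub k s) z))
      = (of_nat k * fst z) *\<^sub>C v_sub k s"
    using v.act_hw_comb[of f_gl z] v.act_hw_comb[of e_gl "typical_act
      (of_int (int (card s) + 1)) (of_int (int k - 1 - int (card s))) f_gl z"]
    by (simp add: typical_act_def hw_comb_def)
qed

text \<open>Uniqueness of the decomposition: the coefficients can be read off from the sum.\<close>

lemma V_sub_sum_coefficients:
  assumes s: "s \<in> Pow {1..k-1}"
    and t: "t = (\<Sum>s\<in>Pow {1..k-1}. hw_comb (tensor_power k) (v_sub k s) (z s))"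
  shows "tensor_act k e_gl (tensor_act k f_gl t) (1 # subset_word k s) = of_nat k * fst (z s)"
    and "tensor_act k e_gl t (1 # subset_word k s) = of_nat k * snd (z s)"
proof -
  let ?w = "\<lambda>s. hw_comb (tensor_power k) (v_sub k s) (z s)"
  have w: "?w s \<in> carrier (tensor_power k)" if "s \<in> Pow {1..k-1}" for s
    using that act_V_sub(1) by blast
  have fw: "tensor_act k f_gl (?w s) \<in> carrier (tensor_power k)" if "s \<in> Pow {1..k-1}" for s
    using tensor.act_carrier[OF w[OF that]] by simp
  have e: "tensor_act k e_gl t = (\<Sum>s\<in>Pow {1..k-1}. (of_nat k * snd (z s)) *\<^sub>C v_sub k s)"
    using tensor.act_sum[where J="Pow {1..k-1}" and g="?w" and k=k and a=e_gl] w
    by (simp add: t act_V_sub)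
  have f: "tensor_act k f_gl t = (\<Sum>s\<in>Pow {1..k-1}. tensor_act k f_gl (?w s))"
    using tensor.act_sum[where J="Pow {1..k-1}" and g="?w" and k=k and a=f_gl] w
    by (simp add: t)
  have ef: "tensor_act k e_gl (tensor_act k f_gl t) =
      (\<Sum>s\<in>Pow {1..k-1}. (of_nat k * fst (z s)) *\<^sub>C v_sub k s)"
    using tensor.act_sum[where J="Pow {1..k-1}" and g="\<lambda>s. tensor_act k f_gl (?w s)" and k=k
        and a=e_gl] fw
    by (simp add: f act_V_sub)
  show "tensor_act k e_gl (tensor_act k f_gl t) (1 # subset_word k s) = of_nat k * fst (z s)"
    "tensor_act k e_gl t (1 # subset_word k s) = of_nat k * snd (z s)"
    unfolding e ef using leading_coefficient[OF s] by simp_all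
qed

text \<open>Existence: expand \<open>e f t\<close> and \<open>e t\<close> in \<open>t = (1/k) (e f t + f (e t))\<close> by the vectors \<open>v\<^sub>s\<close>.\<close>

lemma V_sub_sum_exists:
  assumes t: "t \<in> carrier (tensor_power k)"
  obtains z where "t = (\<Sum>s\<in>Pow {1..k-1}. hw_comb (tensor_power k) (v_sub k s) (z s))"
proof
  define z where "z s =
     (inverse (of_nat k) * tensor_act k e_gl (tensor_act k f_gl t) (1 # subset_word k s),
      inverse (of_nat k) * tensor_act k e_gl t (1 # subset_word k s))" for s
  have ft: "tensor_act k f_gl t \<in> carrier (tensor_power k)"
    using tensor.act_carrier[OF t] by simp
  have v: "v_sub k s \<in> carrier (tensor_power k)" for s
    using tensor.act_carrier[OF basis_tensor_word_carrier] by (simp add: v_sub_eq)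
  have cv: "c *\<^sub>C v_sub k s \<in> carrier (tensor_power k)" for c s
    by (intro cvec.subspace_scale[OF tensor.subspace_carrier] v)
  have "tensor_act k f_gl (tensor_act k e_gl t) =
      tensor_act k f_gl (\<Sum>s\<in>Pow {1..k-1}. tensor_act k e_gl t (1 # subset_word k s) *\<^sub>C v_sub k s)"
    using image_e_expansion[OF t] by simp
  also have "\<dots> = (\<Sum>s\<in>Pow {1..k-1}.
      tensor_act k e_gl t (1 # subset_word k s) *\<^sub>C tensor_act k f_gl (v_sub k s))"
    using tensor.act_sum[OF cv, where a=f_gl] tensor.act_scale[OF v] by simp
  finally have fe: "tensor_act k f_gl (tensor_act k e_gl t) = \<dots>" .
  have "t = inverse (of_nat k) *\<^sub>C
      (tensor_act k e_gl (tensor_act k f_gl t) + tensor_act k f_gl (tensor_act k e_gl t))"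
    using k by (simp add: tensor_power_e_f[OF t] scaleC_scaleC scaleC_one)
  also have "\<dots> = (\<Sum>s\<in>Pow {1..k-1}. hw_comb (tensor_power k) (v_sub k s) (z s))"
    unfolding fe
    by (subst image_e_expansion[OF ft])
      (simp add: hw_comb_def z_def sum.distrib cvec.scale_sum_right scaleC_add_right scaleC_scaleC)
  finally show "t = (\<Sum>s\<in>Pow {1..k-1}. hw_comb (tensor_power k) (v_sub k s) (z s))" .
qed

lemma internal_direct_sum_V_sub: "internal_direct_sum (tensor_power k) (Pow {1..k-1}) (V_sub k)"
  unfolding internal_direct_sum_def
proof (intro conjI ballI)
  show "finite (Pow {1..k-1})" by simp
  show "submodule (tensor_power k) (V_sub k s)" if "s \<in> Pow {1..k-1}" for s
    unfolding V_sub_def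
    by (rule v_sub_typical[OF PowD[OF that]]) (rule typical_highest_weight.submodule_span)
  fix t assume t: "t \<in> carrier (tensor_power k)"
  show "\<exists>!w. w \<in> (\<Pi>\<^sub>E s\<in>Pow {1..k-1}. V_sub k s) \<and> t = (\<Sum>s\<in>Pow {1..k-1}. w s)"
  proof (rule ex_ex1I)
    obtain z where z: "t = (\<Sum>s\<in>Pow {1..k-1}. hw_comb (tensor_power k) (v_sub k s) (z s))"
      using V_sub_sum_exists[OF t] .
    show "\<exists>w. w \<in> (\<Pi>\<^sub>E s\<in>Pow {1..k-1}. V_sub k s) \<and> t = (\<Sum>s\<in>Pow {1..k-1}. w s)"
      by (rule exI[of _ "\<lambda>s\<in>Pow {1..k-1}. hw_comb (tensor_power k) (v_sub k s) (z s)"])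
        (auto simp: V_sub_eq_range z)
  next
    have determined: "w s = hw_comb (tensor_power k) (v_sub k s)
        (inverse (of_nat k) * tensor_act k e_gl (tensor_act k f_gl t) (1 # subset_word k s),
         inverse (of_nat k) * tensor_act k e_gl t (1 # subset_word k s))"
      if w: "w \<in> (\<Pi>\<^sub>E s\<in>Pow {1..k-1}. V_sub k s)" "t = (\<Sum>s\<in>Pow {1..k-1}. w s)"
        and s: "s \<in> Pow {1..k-1}" for w s
    proof -
      have "\<forall>s\<in>Pow {1..k-1}. \<exists>z. w s = hw_comb (tensor_power k) (v_sub k s) z"
        using w(1) by (fastforce simp: PiE_iff V_sub_eq_range)
      then obtain z where z: "\<And>s. s \<in> Pow {1..k-1} \<Longrightarrow> w s = hw_comb (tensor_power k) (v_sub k s) (z s)"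
        by metis
      then have "t = (\<Sum>s\<in>Pow {1..k-1}. hw_comb (tensor_power k) (v_sub k s) (z s))"
        using w(2) by simp
      from V_sub_sum_coefficients[OF s this] show ?thesis
        using k by (simp add: z[OF s] flip: mult.assoc)
    qed
    fix w w'
    assume w: "w \<in> (\<Pi>\<^sub>E s\<in>Pow {1..k-1}. V_sub k s) \<and> t = (\<Sum>s\<in>Pow {1..k-1}. w s)"
      and w': "w' \<in> (\<Pi>\<^sub>E s\<in>Pow {1..k-1}. V_sub k s) \<and> t = (\<Sum>s\<in>Pow {1..k-1}. w' s)"
    show "w = w'"
      by (rule PiE_ext[OF conjunct1[OF w] conjunct1[OF w']]) (use determined w w' in metis)
  qed
qed

end

section \<open>The decomposition\<close>

lemma subsets_by_cardinality:
  fixes n :: nat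
  obtains \<sigma> where "bij_betw \<sigma> (SIGMA l:{0..n}. {..<n choose l}) (Pow {1..n})"
    and "\<And>l j. j < n choose l \<Longrightarrow> card (\<sigma> (l, j)) = l"
proof -
  have "\<forall>l. \<exists>h. bij_betw h {..<n choose l} {s. s \<subseteq> {1..n} \<and> card s = l}"
    by (intro allI finite_same_card_bij) (simp_all add: n_subsets)
  then obtain h where h: "\<And>l. bij_betw (h l) {..<n choose l} {s. s \<subseteq> {1..n} \<and> card s = l}"
    by metis
  let ?\<sigma> = "\<lambda>(l, j). h l j"
  have card: "card (?\<sigma> (l, j)) = l" "?\<sigma> (l, j) \<subseteq> {1..n}" if "j < n choose l" for l j
    using that bij_betw_apply[OF h, of j l] by auto
  have "bij_betw ?\<sigma> (SIGMA l:{0..n}. {..<n choose l}) (Pow {1..n})"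
    unfolding bij_betw_def
  proof (intro conjI equalityI)
    show "inj_on ?\<sigma> (SIGMA l:{0..n}. {..<n choose l})"
    proof (rule inj_onI, clarify)
      fix l j l' j' assume "j < n choose l" "j' < n choose l'" and eq: "h l j = h l' j'"
      then have "l = l'" using card(1)[of j l] card(1)[of j' l'] by simp
      then show "l = l' \<and> j = j'"
        using \<open>j < n choose l\<close> \<open>j' < n choose l'\<close> eq bij_betw_imp_inj_on[OF h[of l]]
        by (auto dest: inj_onD)
    qed
    show "?\<sigma> ` (SIGMA l:{0..n}. {..<n choose l}) \<subseteq> Pow {1..n}" using card(2) by fastforce
    show "Pow {1..n} \<subseteq> ?\<sigma> ` (SIGMA l:{0..n}. {..<n choose l})"
    proof
      fix s assume s: "s \<in> Pow {1..n}"
      then have "card s \<le> n" using card_mono[of "{1..n}" s] by simp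
      moreover obtain j where "j < n choose card s" "s = h (card s) j"
        using s bij_betw_imp_surj_on[OF h[of "card s"]] by blast
      ultimately show "s \<in> ?\<sigma> ` (SIGMA l:{0..n}. {..<n choose l})" by force
    qed
  qed
  then show ?thesis using card(1) by (rule that)
qed

theorem theorem4p3:
  fixes k :: nat
  assumes "k \<ge> 1"
  shows "internal_direct_sum (tensor_power k) (Pow {1..k-1}) (V_sub k) \<and>
         tensor_power k \<cong>\<^sub>g
           direct_sum (SIGMA l:{0..k-1}. {..<(k-1) choose l})
             (\<lambda>(l, j). L (int l + 1) (int k - 1 - int l))"
proof
  let ?J = "SIGMA l:{0..k-1}. {..<(k-1) choose l}"
  let ?N = "\<lambda>(l, j). L (int l + 1) (int k - 1 - int l)"
  show sum: "internal_direct_sum (tensor_power k) (Pow {1..k-1}) (V_sub k)"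
    by (rule internal_direct_sum_V_sub[OF assms])
  obtain \<sigma> where \<sigma>: "bij_betw \<sigma> ?J (Pow {1..k-1})"
    and card_\<sigma>: "\<And>l j. j < (k-1) choose l \<Longrightarrow> card (\<sigma> (l, j)) = l"
    using subsets_by_cardinality[of "k - 1"] by blast
  have is_L: "is_L (int l + 1) (int k - 1 - int l) (?N (l, j))" for l j
    using is_L_L[of "int l + 1" "int k - 1 - int l"] assms by simp
  have N: "is_module (?N j)" if "j \<in> ?J" for j
    using is_L by (cases j) (simp add: is_L_def irreducible_module_def)
  have "\<exists>\<phi>. equivariant_iso (?N j) (carrier (?N j)) (tensor_power k) (V_sub k (\<sigma> j)) \<phi>"
    if j: "j \<in> ?J" for j
  proof -
    obtain l i where li: "j = (l, i)" "i < (k-1) choose l" using j by auto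
    have \<sigma>_j: "\<sigma> j \<subseteq> {1..k-1}" using \<sigma> j by (auto simp: bij_betw_def)
    obtain p where v: "typical_highest_weight (tensor_power k) p
        (of_int (int l + 1)) (of_int (int k - 1 - int l)) (v_sub k (\<sigma> j))"
      using v_sub_typical[OF assms \<sigma>_j] card_\<sigma>[OF li(2)] li(1) by metis
    obtain q w where w: "typical_highest_weight (?N j) q
        (of_int (int l + 1)) (of_int (int k - 1 - int l)) w"
      and gen: "carrier (?N j) = cvec.span {w, act (?N j) f_gl w}"
      using is_L_generated[OF is_L[of l i]] assms unfolding li(1) by auto
    show ?thesis
      unfolding V_sub_def gen by (rule typical_highest_weight_iso[OF w v]) (rule exI)
  qed
  then have "\<forall>j\<in>?J. \<exists>\<phi>. equivariant_iso (?N j) (carrier (?N j)) (tensor_power k) (V_sub k (\<sigma> j)) \<phi>"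
    by (rule ballI)
  from bchoice[OF this] obtain \<phi> where \<phi>:
    "\<forall>j\<in>?J. equivariant_iso (?N j) (carrier (?N j)) (tensor_power k) (V_sub k (\<sigma> j)) (\<phi> j)"
    by (rule exE)
  show "tensor_power k \<cong>\<^sub>g direct_sum ?J ?N"
    by (rule internal_direct_sum_iso[OF is_module_tensor_power sum \<sigma>, where \<phi> = \<phi>])
      (erule N, erule bspec[OF \<phi>])
qed

end
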